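(* For each integer $k\ge 3$, we have $\mu_k^{\mathrm S}=2$ if and only if $f_k(N)=(\log N)^{1-o(1)}$ as $N\to\infty$.
   Context: For integers $k\ge 3$ and $N\ge1$, a set $A\subseteq\{1,\dots,N\}$ is LCM-$k$-free if it does not contain distinct $a_1,\dots,a_k$ such that $\operatorname{lcm}(a_i,a_j)$ is the same for all $1\le i<j\le k$; $f_k(N):=\max\{\sum_{a\in A}1/a : A\subseteq\{1,\dots,N\}\text{ LCM-}k\text{-free}\}$. A collection of $k$ distinct sets $S_1,\dots,S_k$ is a $k$-sunflower if $S_i\cap S_j=S_1\cap S_2$ for all $1\le i<j\le k$; a family is $k$-sunflower-free if no $k$ distinct members form a $k$-sunflower. $F_k(n)$ denotes the maximum size of a $k$-sunflower-free family $\mathcal F\subseteq 2^{[n]}$, and $\mu_k^{\mathrm S}:=\limsup_{n\to\infty}F_k(n)^{1/n}$ (the Erdős–Szemerédi $k$-sunflower-free capacity). The statement $f_k(N)=(\log N)^{1-o(1)}$ means $f_k(N)=(\log N)^{1-\varepsilon(N)}$ with $\varepsilon(N)\to0$. *)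

theory Defs
  imports "HOL-Analysis.Analysis"
begin

definition lcm_free :: "nat \<Rightarrow> nat set \<Rightarrow> bool" where
  "lcm_free k A \<longleftrightarrow>
     \<not> (\<exists>a :: nat \<Rightarrow> nat. inj_on a {1..k} \<and> a ` {1..k} \<subseteq> A \<and>
          (\<exists>L. \<forall>i j. 1 \<le> i \<and> i < j \<and> j \<le> k \<longrightarrow> lcm (a i) (a j) = L))"

definition lcm_free_max :: "nat \<Rightarrow> nat \<Rightarrow> real" where
  "lcm_free_max k N = Max {(\<Sum>a\<in>A. 1 / real a) | A. A \<subseteq> {1..N} \<and> lcm_free k A}"

definition is_sunflower :: "nat \<Rightarrow> (nat \<Rightarrow> 'a set) \<Rightarrow> bool" where
  "is_sunflower k S \<longleftrightarrow> inj_on S {1..k} \<and>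
     (\<forall>i j. 1 \<le> i \<and> i < j \<and> j \<le> k \<longrightarrow> S i \<inter> S j = S 1 \<inter> S 2)"

definition sunflower_free :: "nat \<Rightarrow> 'a set set \<Rightarrow> bool" where
  "sunflower_free k \<F> \<longleftrightarrow> \<not> (\<exists>S. S ` {1..k} \<subseteq> \<F> \<and> is_sunflower k S)"

definition sunflower_free_max :: "nat \<Rightarrow> nat \<Rightarrow> nat" where
  "sunflower_free_max k n = Max {card \<F> | \<F>. \<F> \<subseteq> Pow {1..n} \<and> sunflower_free k \<F>}"

definition sunflower_capacity :: "nat \<Rightarrow> ereal" where
  "sunflower_capacity k = limsup (\<lambda>n. ereal (real (sunflower_free_max k n) powr (1 / real n)))"

text \<open>Both maxima range over finite sets that are nonempty for \<open>k \<ge> 1\<close>, so \<open>Max\<close> is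
  well-defined.\<close>

lemma finite_lcm_free_sums:
  "finite {(\<Sum>a\<in>A. 1 / real a) | A. A \<subseteq> {1..N} \<and> lcm_free k A}"
  by (rule finite_subset[of _ "(\<lambda>A. \<Sum>a\<in>A. 1 / real a) ` Pow {1..N}"]) auto

lemma lcm_free_empty: "k \<ge> 1 \<Longrightarrow> lcm_free k {}"
  by (auto simp: lcm_free_def)

lemma finite_sunflower_free_cards:
  "finite {card \<F> | \<F>. \<F> \<subseteq> Pow {1..n::nat} \<and> sunflower_free k \<F>}"
  by (rule finite_subset[of _ "card ` Pow (Pow {1..n})"]) auto

lemma sunflower_free_empty: "k \<ge> 1 \<Longrightarrow> sunflower_free k {}"
  by (auto simp: sunflower_free_def)

end

theory Submission
  imports Defs "HOL-Computational_Algebra.Squarefree" "HOL-Real_Asymp.Real_Asymp"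
begin

text \<open>
  Taking complements turns sunflowers into tuples of sets with equal pairwise unions, and for
  squarefree integers, viewed as sets of primes, equal unions mean equal LCMs. Both directions then
  change the bias of a product measure by averaging.

  Let \<open>A \<subseteq> {1..N}\<close> be LCM-free with reciprocal sum \<open>(log N)^(1 - o(1))\<close>. Writing \<open>a = s\<^sup>2 r\<close> with \<open>r\<close>
  squarefree, a single \<open>s\<close> carries a positive proportion of the sum. A random set \<open>Q\<close> of primes up
  to \<open>N\<close>, containing \<open>p\<close> with probability \<open>p^(-1-1/log N)\<close>, contains on average \<open>(log N)^(1 - o(1))\<close>
  of the resulting prime sets, while \<open>2^|Q|\<close> has mean at most \<open>1 + log N\<close>. Hence some large \<open>Q\<close> carries a
  union-free family of size \<open>2^((1 - o(1))|Q|)\<close>.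

  Conversely, let \<open>\<F>\<close> be a union-free family of \<open>2^((1 - o(1))n)\<close> subsets of an \<open>n\<close>-set. Fixing a
  random set \<open>T\<close> of elements to be present, some link of \<open>\<F>\<close> is nearly full for the measure with
  weights \<open>\<delta>^|S|\<close>; one of its layers is a uniform union-free family, and uniform families can be raised
  to powers. Replacing each ground element by a group of primes whose reciprocals sum to about \<open>\<delta>\<close>
  and choosing one prime from each group in \<open>S\<close> gives an LCM-free set. It captures a proportion
  \<open>log(1 + \<delta>)/\<delta> \<rightarrow> 1\<close> of the exponent, and \<open>\<Sum>1/p \<ge> log log N - O(1)\<close> is the only arithmetic input.
\<close>

section \<open>Families without equal pairwise unions\<close>

text \<open>Complements inside a common ground set exchange pairwise intersections with pairwise
  unions, so this is the dual of a sunflower. Carrying the common union \<open>U\<close> explicitly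
  lets it be restricted to part of the ground set, or be read off from a common LCM.\<close>

definition equal_unions :: "nat \<Rightarrow> (nat \<Rightarrow> 'a set) \<Rightarrow> 'a set \<Rightarrow> bool" where
  "equal_unions k S U \<longleftrightarrow> (\<forall>i\<in>{1..k}. \<forall>j\<in>{1..k}. i \<noteq> j \<longrightarrow> S i \<union> S j = U)"

definition union_free :: "nat \<Rightarrow> 'a set set \<Rightarrow> bool" where
  "union_free k \<F> \<longleftrightarrow> \<not> (\<exists>S U. inj_on S {1..k} \<and> S ` {1..k} \<subseteq> \<F> \<and> equal_unions k S U)"

lemma equal_unionsD: "equal_unions k S U \<Longrightarrow> i \<in> {1..k} \<Longrightarrow> j \<in> {1..k} \<Longrightarrow> i \<noteq> j \<Longrightarrow> S i \<union> S j = U"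
  by (auto simp: equal_unions_def)

lemma union_freeD:
  "union_free k \<F> \<Longrightarrow> (\<And>i. i \<in> {1..k} \<Longrightarrow> S i \<in> \<F>) \<Longrightarrow> equal_unions k S U \<Longrightarrow> \<not> inj_on S {1..k}"
  unfolding union_free_def by blast

lemma union_freeI:
  assumes "\<And>S U. inj_on S {1..k} \<Longrightarrow> equal_unions k S U \<Longrightarrow> (\<And>i. i \<in> {1..k} \<Longrightarrow> S i \<in> \<F>) \<Longrightarrow> False"
  shows "union_free k \<F>"
  unfolding union_free_def image_subset_iff using assms by blast

lemma sunflower_freeI:
  assumes "\<And>S. is_sunflower k S \<Longrightarrow> (\<And>i. i \<in> {1..k} \<Longrightarrow> S i \<in> \<F>) \<Longrightarrow> False"
  shows "sunflower_free k \<F>"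
  unfolding sunflower_free_def image_subset_iff using assms by blast

lemma sunflower_freeD:
  "sunflower_free k \<F> \<Longrightarrow> (\<And>i. i \<in> {1..k} \<Longrightarrow> S i \<in> \<F>) \<Longrightarrow> \<not> is_sunflower k S"
  unfolding sunflower_free_def by blast

lemma equal_unionsI_less:
  assumes "\<And>i j. 1 \<le> i \<Longrightarrow> i < j \<Longrightarrow> j \<le> k \<Longrightarrow> S i \<union> S j = U"
  shows "equal_unions k S U"
  unfolding equal_unions_def
proof (intro ballI impI)
  fix i j assume "i \<in> {1..k}" "j \<in> {1..k}" "i \<noteq> j"
  then show "S i \<union> S j = U"
    using assms[of i j] assms[of j i] by (cases "i < j") (auto simp: Un_commute)
qed

lemma union_free_subset: "union_free k \<F> \<Longrightarrow> \<G> \<subseteq> \<F> \<Longrightarrow> union_free k \<G>"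
  unfolding union_free_def by blast

lemma sunflower_free_complements:
  assumes "\<F> \<subseteq> Pow V" "union_free k \<F>"
  shows "sunflower_free k ((-) V ` \<F>)"
proof (rule sunflower_freeI)
  fix S assume S: "is_sunflower k S" and img: "\<And>i. i \<in> {1..k} \<Longrightarrow> S i \<in> (-) V ` \<F>"
  have mem: "V - S i \<in> \<F> \<and> S i = V - (V - S i)" if "i \<in> {1..k}" for i
  proof -
    obtain X where X: "X \<in> \<F>" "S i = V - X" using img[OF \<open>i \<in> {1..k}\<close>] by (elim imageE)
    then have eq: "V - S i = X" using assms(1) by blast
    show ?thesis unfolding eq using X by (intro conjI)
  qed
  have "equal_unions k (\<lambda>i. V - S i) (V - (S 1 \<inter> S 2))"
  proof (rule equal_unionsI_less)
    fix i j assume "1 \<le> i" "i < j" "j \<le> k"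
    then have "S i \<inter> S j = S 1 \<inter> S 2" using S unfolding is_sunflower_def by blast
    then show "V - S i \<union> (V - S j) = V - (S 1 \<inter> S 2)" by blast
  qed
  moreover have "inj_on (\<lambda>i. V - S i) {1..k}"
  proof (rule inj_onI)
    fix i j assume ij: "i \<in> {1..k}" "j \<in> {1..k}" "V - S i = V - S j"
    then have "S i = S j" using mem[OF ij(1)] mem[OF ij(2)] by metis
    then show "i = j" using S ij(1,2) unfolding is_sunflower_def by (blast dest: inj_onD)
  qed
  ultimately show False
    using union_freeD[OF assms(2), where S = "\<lambda>i. V - S i", OF conjunct1[OF mem]] by blast
qed

lemma union_free_complements:
  assumes "\<F> \<subseteq> Pow V" "sunflower_free k \<F>" "k \<ge> 2"
  shows "union_free k ((-) V ` \<F>)"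
proof (rule union_freeI)
  fix S U assume S: "inj_on S {1..k}" "equal_unions k S U"
    and img: "\<And>i. i \<in> {1..k} \<Longrightarrow> S i \<in> (-) V ` \<F>"
  have mem: "V - S i \<in> \<F> \<and> S i = V - (V - S i)" if "i \<in> {1..k}" for i
  proof -
    obtain X where X: "X \<in> \<F>" "S i = V - X" using img[OF \<open>i \<in> {1..k}\<close>] by (elim imageE)
    then have eq: "V - S i = X" using assms(1) by blast
    show ?thesis unfolding eq using X by (intro conjI)
  qed
  have "(V - S i) \<inter> (V - S j) = V - U" if "1 \<le> i" "i < j" "j \<le> k" for i j
    using equal_unionsD[OF S(2), of i j] that by auto
  then have "(V - S i) \<inter> (V - S j) = (V - S 1) \<inter> (V - S 2)" if "1 \<le> i" "i < j" "j \<le> k" for i j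
    using that assms(3) by auto
  moreover have "inj_on (\<lambda>i. V - S i) {1..k}"
  proof (rule inj_onI)
    fix i j assume ij: "i \<in> {1..k}" "j \<in> {1..k}" "V - S i = V - S j"
    then have "S i = S j" using mem[OF ij(1)] mem[OF ij(2)] by metis
    then show "i = j" using S(1) ij(1,2) by (blast dest: inj_onD)
  qed
  ultimately have "is_sunflower k (\<lambda>i. V - S i)"
    unfolding is_sunflower_def by blast
  then show False
    using sunflower_freeD[OF assms(2), where S = "\<lambda>i. V - S i", OF conjunct1[OF mem]] by blast
qed

lemma sunflower_free_image:
  assumes "inj_on g V" "\<F> \<subseteq> Pow V" "sunflower_free k \<F>" "k \<ge> 2"
  shows "sunflower_free k ((`) g ` \<F>)"
proof (rule sunflower_freeI)
  fix S assume S: "is_sunflower k S" and img: "\<And>i. i \<in> {1..k} \<Longrightarrow> S i \<in> (`) g ` \<F>"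
  have "\<forall>i\<in>{1..k}. \<exists>X\<in>\<F>. S i = g ` X" using img by blast
  then obtain S' where S': "\<And>i. i \<in> {1..k} \<Longrightarrow> S' i \<in> \<F>" "\<And>i. i \<in> {1..k} \<Longrightarrow> S i = g ` S' i"
    by metis
  have sub: "S' i \<subseteq> V" if "i \<in> {1..k}" for i using S'(1)[OF that] assms(2) by blast
  have "S' i \<inter> S' j = S' 1 \<inter> S' 2" if "1 \<le> i" "i < j" "j \<le> k" for i j
  proof -
    have "g ` (S' i \<inter> S' j) = S i \<inter> S j"
      using inj_on_image_Int[OF assms(1) sub sub, of i j] S'(2) that by auto
    also have "\<dots> = S 1 \<inter> S 2" using S that unfolding is_sunflower_def by blast
    also have "\<dots> = g ` (S' 1 \<inter> S' 2)"
      using inj_on_image_Int[OF assms(1) sub sub, of 1 2] S'(2) assms(4) by auto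
    finally show ?thesis
      using inj_on_image_eq_iff[OF assms(1), of "S' i \<inter> S' j" "S' 1 \<inter> S' 2"] sub[of i] sub[of 1] that
      by auto
  qed
  moreover have "inj_on S' {1..k}"
  proof (rule inj_onI)
    fix i j assume ij: "i \<in> {1..k}" "j \<in> {1..k}" "S' i = S' j"
    then have "S i = S j" using S'(2) by simp
    then show "i = j" using S ij(1,2) unfolding is_sunflower_def by (blast dest: inj_onD)
  qed
  ultimately have "is_sunflower k S'" unfolding is_sunflower_def by blast
  then show False using sunflower_freeD[OF assms(3), where S = S', OF S'(1)] by blast
qed

text \<open>Complementation in \<open>V\<close> and relabelling of \<open>V\<close> by
  \<open>{1..card V}\<close> both keep the number of members. This makes ground sets such as sets of
  primes available.\<close>

lemma card_le_sunflower_free_max: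
  assumes "finite V" "\<F> \<subseteq> Pow V" "union_free k \<F>" "k \<ge> 2"
  shows "card \<F> \<le> sunflower_free_max k (card V)"
proof -
  obtain g where g: "bij_betw g V {1..card V}"
    using finite_same_card_bij[OF assms(1), of "{1..card V}"] by auto
  let ?G = "(`) g ` ((-) V ` \<F>)"
  have inj: "inj_on g V" and img: "g ` V = {1..card V}" using g by (auto simp: bij_betw_def)
  have "inj_on ((-) V) \<F>" using assms(2) by (intro inj_onI) blast
  moreover have "inj_on ((`) g) ((-) V ` \<F>)"
    using inj by (intro inj_on_image) (auto intro: inj_on_subset)
  ultimately have card: "card ?G = card \<F>" by (simp add: card_image)
  have "sunflower_free k ?G"
    using sunflower_free_complements[OF assms(2,3)] inj assms(4)
    by (intro sunflower_free_image) auto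
  moreover have "?G \<subseteq> Pow {1..card V}" using img by blast
  ultimately have "card ?G \<in> {card \<F> |\<F>. \<F> \<subseteq> Pow {1..card V} \<and> sunflower_free k \<F>}" by blast
  then show ?thesis
    unfolding sunflower_free_max_def card[symmetric]
    by (rule Max_ge[OF finite_sunflower_free_cards])
qed

lemma obtain_union_free:
  assumes "k \<ge> 2"
  obtains \<F> where "\<F> \<subseteq> Pow {1..n}" "union_free k \<F>" "card \<F> = sunflower_free_max k n"
proof -
  let ?M = "{card \<F> |\<F>. \<F> \<subseteq> Pow {1..n} \<and> sunflower_free k \<F>}"
  have "sunflower_free k ({} :: nat set set)" using assms by (intro sunflower_free_empty) simp
  then have "card ({} :: nat set set) \<in> ?M" by blast
  then have "?M \<noteq> {}" by blast
  then have "Max ?M \<in> ?M" by (rule Max_in[OF finite_sunflower_free_cards])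
  then obtain \<F> where F: "\<F> \<subseteq> Pow {1..n}" "sunflower_free k \<F>" "card \<F> = Max ?M"
    unfolding mem_Collect_eq by metis
  have "inj_on ((-) {1..n}) \<F>" using F(1) by (intro inj_onI) blast
  then have "card ((-) {1..n} ` \<F>) = sunflower_free_max k n"
    using F(3) by (simp add: card_image sunflower_free_max_def)
  then show thesis
    using union_free_complements[OF F(1,2) assms] by (intro that[of "(-) {1..n} ` \<F>"]) auto
qed

lemma sunflower_free_max_le: "k \<ge> 2 \<Longrightarrow> sunflower_free_max k n \<le> 2 ^ n"
proof -
  assume "k \<ge> 2"
  then obtain \<F> where "\<F> \<subseteq> Pow {1..n}" "card \<F> = sunflower_free_max k n"
    using obtain_union_free by metis
  then show ?thesis using card_mono[of "Pow {1..n}" \<F>] by (simp add: card_Pow)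
qed

section \<open>Random subsets\<close>

lemma sum_Pow_prod:
  fixes f g :: "'a \<Rightarrow> 'b::comm_semiring_1"
  assumes "finite P"
  shows "(\<Sum>Q\<in>Pow P. prod f Q * prod g (P - Q)) = (\<Prod>p\<in>P. f p + g p)"
  using prod_add[OF assms, of f g] by simp

lemma sum_Pow_power:
  fixes a b :: "'b::comm_semiring_1"
  assumes "finite P"
  shows "(\<Sum>Q\<in>Pow P. a ^ card Q * b ^ card (P - Q)) = (a + b) ^ card P"
  using sum_Pow_prod[OF assms, of "\<lambda>_. a" "\<lambda>_. b"] by simp

text \<open>Including each \<open>p\<close> independently with probability \<open>x p\<close>, the set \<open>X\<close> is covered with
  probability \<open>prod x X\<close>.\<close>

lemma sum_supersets_prod:
  fixes x :: "'a \<Rightarrow> real"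
  assumes "finite P" "X \<subseteq> P"
  shows "(\<Sum>Q\<in>Pow P. if X \<subseteq> Q then prod x Q * (\<Prod>p\<in>P - Q. 1 - x p) else 0) = prod x X"
proof -
  let ?g = "\<lambda>p. if p \<in> X then 0 else 1 - x p"
  have "prod x Q * prod ?g (P - Q) = (if X \<subseteq> Q then prod x Q * (\<Prod>p\<in>P - Q. 1 - x p) else 0)"
    if "Q \<in> Pow P" for Q
  proof (cases "X \<subseteq> Q")
    case True
    then have "prod ?g (P - Q) = (\<Prod>p\<in>P - Q. 1 - x p)" by (intro prod.cong) auto
    then show ?thesis using True by simp
  next
    case False
    then obtain p where "p \<in> P - Q" "p \<in> X" using assms by auto
    then have "prod ?g (P - Q) = 0" using assms(1) by (intro prod_zero) auto
    then show ?thesis using False by simp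
  qed
  then have "(\<Sum>Q\<in>Pow P. if X \<subseteq> Q then prod x Q * (\<Prod>p\<in>P - Q. 1 - x p) else 0) =
      (\<Prod>p\<in>P. x p + ?g p)"
    by (simp add: sum_Pow_prod[OF assms(1), symmetric])
  also have "\<dots> = (\<Prod>p\<in>P. if p \<in> X then x p else 1)" by (intro prod.cong) auto
  also have "\<dots> = prod x X"
    using assms by (simp add: prod.If_cases Int_absorb1)
  finally show ?thesis .
qed

text \<open>For the random set \<open>Q\<close> above, \<open>card {X \<in> \<B>. X \<subseteq> Q}\<close> has mean \<open>W\<close> while
  \<open>2 ^ card Q\<close> has mean \<open>\<Prod>p\<in>P. 1 + x p\<close>.\<close>

lemma dense_on_large_subset:
  fixes x :: "'a \<Rightarrow> real"
  assumes fin: "finite P" and x: "\<And>p. p \<in> P \<Longrightarrow> 0 \<le> x p \<and> x p \<le> 1"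
    and B: "\<B> \<subseteq> Pow P" and W: "W = (\<Sum>X\<in>\<B>. prod x X)" "W > 2 ^ (n + 1)"
  obtains Q where "Q \<subseteq> P" "n \<le> card Q"
    "2 ^ card Q * W \<le> 2 * real (card {X\<in>\<B>. X \<subseteq> Q}) * (\<Prod>p\<in>P. 1 + x p)"
proof (rule ccontr)
  note witness = that
  assume neg: "\<not> thesis"
  define Z where "Z = (\<Prod>p\<in>P. 1 + x p)"
  define w where "w Q = prod x Q * (\<Prod>p\<in>P - Q. 1 - x p)" for Q
  define c where "c Q = real (card {X\<in>\<B>. X \<subseteq> Q})" for Q
  have finB: "finite \<B>" using B fin by (meson finite_Pow_iff finite_subset)
  have Z: "Z > 0" unfolding Z_def using x by (intro prod_pos) force
  have Wpos: "W > 0" using W(2) zero_less_power[of "2::real" "n + 1"] by linarith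
  have w: "w Q \<ge> 0" if "Q \<in> Pow P" for Q
    unfolding w_def using x that by (intro mult_nonneg_nonneg prod_nonneg) auto
  \<comment> \<open>A small \<open>Q\<close> falls outside the negated conclusion; there the trivial
    bound \<open>2 ^ n\<close> on the number of subsets is used, and \<open>W > 2 ^ (n + 1)\<close>
    pays for it at the end.\<close>
  have c1: "c Q \<le> 2 ^ card Q * (W / (2 * Z)) + 2 ^ n" if "Q \<in> Pow P" for Q
  proof (cases "n \<le> card Q")
    case True
    then have "2 * c Q * Z < 2 ^ card Q * W"
      using neg witness[of Q] \<open>Q \<in> Pow P\<close> unfolding c_def Z_def by force
    then have "c Q \<le> 2 ^ card Q * (W / (2 * Z))" using Z by (simp add: field_simps)
    then show ?thesis using zero_less_power[of "2::real" n] by linarith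
  next
    case False
    have "finite Q" using that fin by (auto intro: finite_subset)
    then have "card {X\<in>\<B>. X \<subseteq> Q} \<le> card (Pow Q)" by (intro card_mono) auto
    also have "\<dots> = 2 ^ card Q" using \<open>finite Q\<close> by (simp add: card_Pow)
    also have "\<dots> \<le> 2 ^ n" using False by (intro power_increasing) auto
    finally have "c Q \<le> 2 ^ n" unfolding c_def by (metis of_nat_le_iff of_nat_numeral of_nat_power)
    moreover have "0 \<le> 2 ^ card Q * (W / (2 * Z))" using Z Wpos by simp
    ultimately show ?thesis by linarith
  qed
  have w1: "(\<Sum>Q\<in>Pow P. w Q) = 1"
    unfolding w_def by (simp add: sum_Pow_prod[OF fin])
  have w2: "(\<Sum>Q\<in>Pow P. w Q * 2 ^ card Q) = Z"
  proof -
    have "(\<Sum>Q\<in>Pow P. w Q * 2 ^ card Q) =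
        (\<Sum>Q\<in>Pow P. (\<Prod>p\<in>Q. 2 * x p) * (\<Prod>p\<in>P - Q. 1 - x p))"
      unfolding w_def by (simp add: prod.distrib algebra_simps)
    also have "\<dots> = Z" unfolding Z_def by (simp add: sum_Pow_prod[OF fin] add.commute)
    finally show ?thesis .
  qed
  have "W = (\<Sum>X\<in>\<B>. \<Sum>Q\<in>Pow P. if X \<subseteq> Q then w Q else 0)"
    unfolding W(1) w_def using B by (intro sum.cong refl sum_supersets_prod[symmetric] fin) auto
  also have "\<dots> = (\<Sum>Q\<in>Pow P. \<Sum>X\<in>\<B>. if X \<subseteq> Q then w Q else 0)" by (rule sum.swap)
  also have "\<dots> = (\<Sum>Q\<in>Pow P. w Q * c Q)"
    unfolding c_def using finB by (intro sum.cong refl) (simp add: sum.If_cases Int_def)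
  also have "\<dots> \<le> (\<Sum>Q\<in>Pow P. w Q * (2 ^ card Q * (W / (2 * Z)) + 2 ^ n))"
    using w c1 by (intro sum_mono mult_left_mono) auto
  also have "\<dots> = (\<Sum>Q\<in>Pow P. w Q * 2 ^ card Q) * (W / (2 * Z)) + (\<Sum>Q\<in>Pow P. w Q) * 2 ^ n"
    by (simp add: distrib_left sum.distrib sum_distrib_right sum_divide_distrib mult.assoc)
  also have "\<dots> = W / 2 + 2 ^ n" using Z by (simp add: w1 w2)
  finally show False using W(2) by simp
qed

text \<open>Here \<open>T\<close> carries weight \<open>(1 - \<delta>) ^ card T\<close>: each \<open>S \<in> \<F>\<close> then has total weight \<open>1\<close> over its
  subsets \<open>T\<close>, and the right-hand sides \<open>(1 + \<delta>) ^ card (V - T)\<close> add up to \<open>2 ^ card V\<close>.\<close>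

lemma dense_link:
  fixes \<delta> \<rho> :: real
  assumes fin: "finite V" and F: "\<F> \<subseteq> Pow V" and \<delta>: "0 \<le> \<delta>" "\<delta> \<le> 1" and \<rho>: "\<rho> \<ge> 0"
    and card: "real (card \<F>) > \<rho> * 2 ^ card V + (1 + \<delta>) ^ q * (2 - \<delta>) ^ card V"
  obtains T where "T \<subseteq> V" "q \<le> card (V - T)"
    "(\<Sum>S | S \<in> \<F> \<and> T \<subseteq> S. \<delta> ^ card (S - T)) \<ge> \<rho> * (1 + \<delta>) ^ card (V - T)"
proof (rule ccontr)
  note witness = that
  assume neg: "\<not> thesis"
  define W where "W T = (\<Sum>S | S \<in> \<F> \<and> T \<subseteq> S. \<delta> ^ card (S - T))" for T
  have finF: "finite \<F>" using F fin by (meson finite_Pow_iff finite_subset)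
  \<comment> \<open>For small \<open>V - T\<close> the weight of the whole power set is used
    instead. Averaged over \<open>T\<close>, this accounts for the term
    \<open>(1 + \<delta>) ^ q * (2 - \<delta>) ^ card V\<close> of the hypothesis.\<close>
  have W: "W T \<le> \<rho> * (1 + \<delta>) ^ card (V - T) + (1 + \<delta>) ^ q" if "T \<in> Pow V" for T
  proof (cases "q \<le> card (V - T)")
    case True
    then have "W T < \<rho> * (1 + \<delta>) ^ card (V - T)"
      using neg witness[of T] \<open>T \<in> Pow V\<close> unfolding W_def by force
    moreover have "0 \<le> (1 + \<delta>) ^ q" using \<delta> by simp
    ultimately show ?thesis by linarith
  next
    case False
    have "W T = (\<Sum>Y\<in>(\<lambda>S. S - T) ` {S. S \<in> \<F> \<and> T \<subseteq> S}. \<delta> ^ card Y)"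
      unfolding W_def by (subst sum.reindex) (auto intro!: inj_onI)
    also have "\<dots> \<le> (\<Sum>Y\<in>Pow (V - T). \<delta> ^ card Y)"
      using fin F \<delta> by (intro sum_mono2) auto
    also have "\<dots> = (1 + \<delta>) ^ card (V - T)"
      using sum_Pow_power[of "V - T" \<delta> 1] fin by (simp add: add.commute)
    also have "\<dots> \<le> (1 + \<delta>) ^ q" using False \<delta> by (intro power_increasing) auto
    moreover have "0 \<le> \<rho> * (1 + \<delta>) ^ card (V - T)" using \<delta> \<rho> by simp
    ultimately show ?thesis by linarith
  qed
  have inner: "(\<Sum>T\<in>Pow V. if T \<subseteq> S then (1 - \<delta>) ^ card T * \<delta> ^ card (S - T) else 0) = 1"
    if "S \<in> \<F>" for S
  proof -
    have "S \<subseteq> V" using that F by blast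
    then have "(\<Sum>T\<in>Pow V. if T \<subseteq> S then (1 - \<delta>) ^ card T * \<delta> ^ card (S - T) else 0) =
        (\<Sum>T\<in>Pow S. (1 - \<delta>) ^ card T * \<delta> ^ card (S - T))"
      using fin by (intro sum.mono_neutral_cong_right) auto
    also have "\<dots> = 1" using sum_Pow_power[of S "1 - \<delta>" \<delta>] finite_subset[OF \<open>S \<subseteq> V\<close> fin] by simp
    finally show ?thesis .
  qed
  have "real (card \<F>) =
      (\<Sum>S\<in>\<F>. \<Sum>T\<in>Pow V. if T \<subseteq> S then (1 - \<delta>) ^ card T * \<delta> ^ card (S - T) else 0)"
    by (simp add: inner)
  also have "\<dots> = (\<Sum>T\<in>Pow V. \<Sum>S\<in>\<F>. if T \<subseteq> S then (1 - \<delta>) ^ card T * \<delta> ^ card (S - T) else 0)"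
    by (rule sum.swap)
  also have "\<dots> = (\<Sum>T\<in>Pow V. (1 - \<delta>) ^ card T * W T)"
    unfolding W_def using finF
    by (intro sum.cong refl) (simp add: sum.If_cases Int_def sum_distrib_left)
  also have "\<dots> \<le> (\<Sum>T\<in>Pow V. (1 - \<delta>) ^ card T * (\<rho> * (1 + \<delta>) ^ card (V - T) + (1 + \<delta>) ^ q))"
    using W \<delta> by (intro sum_mono mult_left_mono) auto
  also have "\<dots> = \<rho> * (\<Sum>T\<in>Pow V. (1 - \<delta>) ^ card T * (1 + \<delta>) ^ card (V - T)) +
      (1 + \<delta>) ^ q * (\<Sum>T\<in>Pow V. (1 - \<delta>) ^ card T * 1 ^ card (V - T))"
    by (simp add: distrib_left sum.distrib sum_distrib_left mult_ac)
  also have "\<dots> = \<rho> * 2 ^ card V + (1 + \<delta>) ^ q * (2 - \<delta>) ^ card V"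
    by (simp only: sum_Pow_power[OF fin]) simp
  finally show False using card by simp
qed

text \<open>Putting \<open>T\<close> back is injective on sets disjoint from \<open>T\<close>, and
  it turns a common union \<open>U\<close> into \<open>U \<union> T\<close>.\<close>

lemma union_free_link:
  assumes "union_free k \<F>"
  shows "union_free k ((\<lambda>S. S - T) ` {S. S \<in> \<F> \<and> T \<subseteq> S})"
proof (rule union_freeI)
  fix S U assume S: "inj_on S {1..k}" "equal_unions k S U"
    and mem: "\<And>i. i \<in> {1..k} \<Longrightarrow> S i \<in> (\<lambda>S. S - T) ` {S. S \<in> \<F> \<and> T \<subseteq> S}"
  have mem': "S i \<union> T \<in> \<F> \<and> S i \<inter> T = {}" if "i \<in> {1..k}" for i
  proof -
    obtain X where X: "X \<in> \<F>" "T \<subseteq> X" "S i = X - T" using mem[OF \<open>i \<in> {1..k}\<close>] by blast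
    then have "S i \<union> T = X" by blast
    then show ?thesis using X by auto
  qed
  have "equal_unions k (\<lambda>i. S i \<union> T) (U \<union> T)"
    using S(2) unfolding equal_unions_def by blast
  moreover have "inj_on (\<lambda>i. S i \<union> T) {1..k}"
  proof (rule inj_onI)
    fix i j assume "i \<in> {1..k}" "j \<in> {1..k}" "S i \<union> T = S j \<union> T"
    then have "S i = S j" using mem' by blast
    then show "i = j" using S(1) \<open>i \<in> {1..k}\<close> \<open>j \<in> {1..k}\<close> by (auto dest: inj_onD)
  qed
  ultimately show False using union_freeD[OF assms, where S = "\<lambda>i. S i \<union> T", OF conjunct1[OF mem']] by blast
qed

section \<open>Powers of uniform families\<close>

text \<open>Without uniformity, \<open>S i = S j\<close> would only force the other members to be subsets of \<open>S i\<close>,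
  and products of union-free families need not be union-free.\<close>

lemma union_free_uniform_const:
  assumes "union_free k \<F>" "\<And>S. S \<in> \<F> \<Longrightarrow> finite S \<and> card S = m"
    and S: "\<And>i. i \<in> {1..k} \<Longrightarrow> S i \<in> \<F>" "equal_unions k S U" and ij: "i \<in> {1..k}" "j \<in> {1..k}"
  shows "S i = S j"
proof -
  obtain a b where ab: "a \<in> {1..k}" "b \<in> {1..k}" "a \<noteq> b" "S a = S b"
    using union_freeD[OF assms(1) S] unfolding inj_on_def by blast
  have "S l = S a" if "l \<in> {1..k}" for l
  proof (cases "l = a")
    case False
    have "S l \<union> S a = S a \<union> S b"
      using equal_unionsD[OF S(2), of l a] equal_unionsD[OF S(2), of a b] that ab False by simp
    then have "S l \<subseteq> S a" using ab(4) by blast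
    then show ?thesis
      using assms(2)[OF S(1)[OF that]] assms(2)[OF S(1)[OF ab(1)]] by (intro card_subset_eq) auto
  qed simp
  then show ?thesis using ij by simp
qed

text \<open>The family is the \<open>R\<close>-fold product of \<open>\<U>\<close> over disjoint
  copies of \<open>V\<close>, built one copy at a time. Equal unions restrict to each factor, where
  uniformity makes the tuple constant, so its members cannot be distinct.\<close>

lemma union_free_uniform_power:
  assumes "union_free k \<U>" "\<U> \<subseteq> Pow V" "\<And>S. S \<in> \<U> \<Longrightarrow> card S = m" "finite V" "k \<ge> 2"
  shows "\<exists>\<G>. \<G> \<subseteq> Pow ({..<R::nat} \<times> V) \<and> union_free k \<G> \<and> (\<forall>S\<in>\<G>. card S = R * m) \<and>
    card \<G> = card \<U> ^ R"
proof (induction R)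
  case 0
  have "union_free k {{} :: (nat \<times> 'a) set}"
  proof (rule union_freeI)
    fix S U assume S: "inj_on S {1..k}" and "\<And>i. i \<in> {1..k} \<Longrightarrow> S i \<in> {{} :: (nat \<times> 'a) set}"
    moreover have mem: "1 \<in> {1..k}" "2 \<in> {1..k}" using assms(5) by auto
    ultimately have "S 1 = S 2" by blast
    then show False using inj_onD[OF S _ mem] by simp
  qed
  then show ?case by (intro exI[of _ "{{}}"]) auto
next
  case (Suc R)
  then obtain \<G> where G: "\<G> \<subseteq> Pow ({..<R} \<times> V)" "union_free k \<G>"
    "\<forall>S\<in>\<G>. card S = R * m" "card \<G> = card \<U> ^ R" by (elim exE conjE)
  \<comment> \<open>\<open>\<phi>\<close> places a member of \<open>\<U>\<close> on the fresh block
    with first coordinate \<open>R\<close>; both components are recovered as traces of the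
    result.\<close>
  define \<phi> where "\<phi> = (\<lambda>(A, B). A \<union> Pair R ` B :: (nat \<times> 'a) set)"
  have lo: "\<phi> (A, B) \<inter> ({..<R} \<times> V) = A" and hi: "Pair R -` \<phi> (A, B) = B"
    if "A \<in> \<G>" for A B
    using that G(1) by (auto simp: \<phi>_def)
  have finU: "finite S" if "S \<in> \<U>" for S using that assms(2,4) by (auto intro: finite_subset)
  have finG: "finite S" if "S \<in> \<G>" for S
    using that G(1) assms(4) finite_subset[of S "{..<R} \<times> V"] by auto
  have inj: "inj_on \<phi> (\<G> \<times> \<U>)"
  proof (rule inj_onI, clarify)
    fix A B A' B' assume "A \<in> \<G>" "A' \<in> \<G>" "\<phi> (A, B) = \<phi> (A', B')"
    then show "A = A' \<and> B = B'" using lo hi by metis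
  qed
  have "union_free k (\<phi> ` (\<G> \<times> \<U>))"
  proof (rule union_freeI)
    fix S U assume S: "inj_on S {1..k}" "equal_unions k S U"
      and mem: "\<And>i. i \<in> {1..k} \<Longrightarrow> S i \<in> \<phi> ` (\<G> \<times> \<U>)"
    define A where "A i = S i \<inter> ({..<R} \<times> V)" for i
    define B where "B i = Pair R -` S i" for i
    have AB: "A i \<in> \<G> \<and> B i \<in> \<U> \<and> S i = \<phi> (A i, B i)" if "i \<in> {1..k}" for i
      using mem[OF that] lo hi unfolding A_def B_def by auto
    have "equal_unions k A (U \<inter> ({..<R} \<times> V))"
      unfolding equal_unions_def A_def
      using equal_unionsD[OF S(2)] by (auto simp: Int_Un_distrib2[symmetric])
    then have "A 1 = A 2"
      using AB G finG assms(5) by (intro union_free_uniform_const[OF G(2)]) auto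
    moreover have "equal_unions k B (Pair R -` U)"
      unfolding equal_unions_def B_def
      using equal_unionsD[OF S(2)] by (auto simp: vimage_Un[symmetric])
    then have "B 1 = B 2"
      using AB assms finU by (intro union_free_uniform_const[OF assms(1)]) auto
    ultimately have "S 1 = S 2" using AB[of 1] AB[of 2] assms(5) by simp
    then show False using inj_onD[OF S(1), of 1 2] assms(5) by simp
  qed
  moreover have "\<phi> ` (\<G> \<times> \<U>) \<subseteq> Pow ({..<Suc R} \<times> V)"
  proof
    fix S assume "S \<in> \<phi> ` (\<G> \<times> \<U>)"
    then obtain A B where "A \<in> \<G>" "B \<in> \<U>" "S = A \<union> Pair R ` B" by (auto simp: \<phi>_def)
    moreover from this have "A \<subseteq> {..<R} \<times> V" "B \<subseteq> V" using G(1) assms(2) by auto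
    ultimately show "S \<in> Pow ({..<Suc R} \<times> V)" by auto
  qed
  moreover have "card S = Suc R * m" if "S \<in> \<phi> ` (\<G> \<times> \<U>)" for S
  proof -
    obtain A B where S: "A \<in> \<G>" "B \<in> \<U>" "S = A \<union> Pair R ` B" using \<open>S \<in> _\<close> by (auto simp: \<phi>_def)
    moreover have "A \<inter> Pair R ` B = {}" using S(1) G(1) by auto
    ultimately show ?thesis
      using G(3) assms(3) finU finG by (simp add: card_Un_disjoint card_image inj_on_def)
  qed
  moreover have "card (\<phi> ` (\<G> \<times> \<U>)) = card \<U> ^ Suc R"
    using inj G(4) by (simp add: card_image card_cartesian_product)
  ultimately show ?case by (intro exI[of _ "\<phi> ` (\<G> \<times> \<U>)"]) simp
qed

text \<open>With weights \<open>\<delta> ^ card S\<close> the full power set has mass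
  \<open>(1 + \<delta>) ^ card V\<close>, whose exponent per element is \<delta> - O(\<delta>^2).
  The weaker rate \<open>\<delta> * (1 - 2 * \<delta>)\<close> leaves room for the density lost in
  passing to a link and for the factor \<open>card V + 1\<close> lost in keeping a single
  layer.\<close>

lemma exists_dense_uniform_union_free:
  fixes \<delta> :: real
  assumes k: "k \<ge> 2" and cap: "sunflower_capacity k = 2" and \<delta>: "0 < \<delta>" "\<delta> < 1"
  obtains V :: "nat set" and \<U> m where "finite V" "V \<noteq> {}" "\<U> \<subseteq> Pow V" "union_free k \<U>"
    "\<And>S. S \<in> \<U> \<Longrightarrow> card S = m"
    "real (card \<U>) * \<delta> ^ m \<ge> exp (real (card V) * \<delta> * (1 - 2 * \<delta>))"
proof -
  \<comment> \<open>The link will cost \<open>2 * \<epsilon> * n\<close> in the exponent, where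
    \<open>n \<le> 4 * v + 3\<close>; with this \<epsilon> that is at most \<delta>^2 * v / 4 plus a
    constant.\<close>
  define \<epsilon> where "\<epsilon> = \<delta>\<^sup>2 / 32"
  have \<epsilon>: "\<epsilon> > 0" using \<delta> by (simp add: \<epsilon>_def)
  have "\<forall>\<^sub>F n in sequentially. 8 * \<epsilon> * real n + 6 * \<epsilon> + ln (real n + 1) \<le> \<delta>\<^sup>2 * real n"
    using \<delta> unfolding \<epsilon>_def by real_asymp
  then obtain n0 where n0: "\<And>n. n \<ge> n0 \<Longrightarrow> 8 * \<epsilon> * real n + 6 * \<epsilon> + ln (real n + 1) \<le> \<delta>\<^sup>2 * real n"
    by (auto simp: eventually_sequentially)
  have "\<forall>\<^sub>F n in sequentially. exp (\<epsilon> * real n) > 2"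
    using \<epsilon> by real_asymp
  then obtain n1 where n1: "\<And>n. n \<ge> n1 \<Longrightarrow> exp (\<epsilon> * real n) > 2"
    by (auto simp: eventually_sequentially)
  \<comment> \<open>The capacity is a limsup, so dense families exist for infinitely many
    \<open>n\<close> only; this suffices to find one beyond both thresholds.\<close>
  have "\<not> (\<forall>\<^sub>F n in sequentially.
      ereal (real (sunflower_free_max k n) powr (1 / real n)) \<le> ereal (2 * exp (- \<epsilon>)))"
  proof
    assume "\<forall>\<^sub>F n in sequentially.
      ereal (real (sunflower_free_max k n) powr (1 / real n)) \<le> ereal (2 * exp (- \<epsilon>))"
    then have "sunflower_capacity k \<le> ereal (2 * exp (- \<epsilon>))"
      unfolding sunflower_capacity_def by (rule Limsup_bounded)
    then have "(2::real) \<le> 2 * exp (- \<epsilon>)" unfolding cap by (metis ereal_less_eq(3) numeral_eq_ereal)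
    then show False using \<epsilon> by simp
  qed
  then obtain n where n: "n \<ge> 4 * n0 + 4 + n1"
    "\<not> real (sunflower_free_max k n) powr (1 / real n) \<le> 2 * exp (- \<epsilon>)"
    unfolding eventually_sequentially ereal_less_eq by blast
  have npos: "n > 0" using n(1) by simp
  obtain \<F> where F: "\<F> \<subseteq> Pow {1..n}" "union_free k \<F>" "card \<F> = sunflower_free_max k n"
    using obtain_union_free[OF k] by metis
  have cardF: "real (card \<F>) > 2 ^ n * exp (- \<epsilon> * real n)"
  proof (rule ccontr)
    have root: "(c ^ n) powr (1 / real n) = c" if "c > 0" for c :: real
      using that npos by (simp add: powr_realpow[symmetric] powr_powr)
    assume "\<not> ?thesis"
    then have "real (card \<F>) \<le> (2 * exp (- \<epsilon>)) ^ n"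
      by (simp add: power_mult_distrib exp_of_nat_mult[symmetric] mult.commute)
    then have "real (card \<F>) powr (1 / real n) \<le> ((2 * exp (- \<epsilon>)) ^ n) powr (1 / real n)"
      by (intro powr_mono2) auto
    also have "\<dots> = 2 * exp (- \<epsilon>)" by (rule root) simp
    finally show False using n(2) F(3) by simp
  qed
  \<comment> \<open>For \<open>q\<close> about \<open>n / 4\<close>, the factor
    \<open>exp (q * \<delta>)\<close> is outweighed by the bound
    \<open>exp (- n * \<delta> / 2)\<close> for (1 - \<delta>/2)^n. Links on small ground sets are
    thus negligible, yet \<open>q\<close> still exceeds \<open>n0\<close>.\<close>
  define q where "q = n div 4"
  define \<rho> where "\<rho> = exp (- 2 * \<epsilon> * real n)"
  have b1: "(1 + \<delta>) ^ q * (2 - \<delta>) ^ n \<le> 2 ^ n * \<rho>"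
  proof -
    have "(1 + \<delta>) ^ q \<le> exp \<delta> ^ q" using \<delta> by (intro power_mono) auto
    also have "\<dots> = exp (real q * \<delta>)" by (simp add: exp_of_nat_mult)
    finally have a: "(1 + \<delta>) ^ q \<le> exp (real q * \<delta>)" .
    have "(2 - \<delta>) ^ n = 2 ^ n * (1 + (- \<delta> / 2)) ^ n"
      by (subst power_mult_distrib[symmetric]) (simp add: algebra_simps)
    also have "\<dots> \<le> 2 ^ n * exp (- \<delta> / 2) ^ n"
      using \<delta> exp_ge_add_one_self[of "- \<delta> / 2"] by (intro mult_left_mono power_mono) auto
    also have "\<dots> = 2 ^ n * exp (real n * (- \<delta> / 2))" by (simp only: exp_of_nat_mult)
    finally have "(1 + \<delta>) ^ q * (2 - \<delta>) ^ n \<le> exp (real q * \<delta>) * (2 ^ n * exp (real n * (- \<delta> / 2)))"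
      using a \<delta> by (intro mult_mono) auto
    also have "\<dots> = 2 ^ n * exp (real q * \<delta> + real n * (- \<delta> / 2))"
      by (simp only: exp_add mult_ac)
    also have "\<dots> \<le> 2 ^ n * \<rho>"
    proof -
      have "real q * 4 \<le> real n" unfolding q_def by linarith
      then have "real q * 4 * \<delta> \<le> real n * \<delta>" using \<delta> by (intro mult_right_mono) auto
      moreover have "2 * \<epsilon> * real n \<le> \<delta> / 4 * real n"
        using \<delta> by (intro mult_right_mono) (auto simp: \<epsilon>_def power2_eq_square)
      ultimately have "real q * \<delta> + real n * (- \<delta> / 2) \<le> - 2 * \<epsilon> * real n"
        by (simp add: algebra_simps)
      then show ?thesis unfolding \<rho>_def by simp
    qed
    finally show ?thesis .
  qed
  have "\<rho> * 2 ^ card {1..n} + (1 + \<delta>) ^ q * (2 - \<delta>) ^ card {1..n} \<le> 2 ^ n * (2 * \<rho>)"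
    using b1 by (simp add: mult.commute)
  also have "\<dots> \<le> 2 ^ n * exp (- \<epsilon> * real n)"
  proof -
    have "2 * \<rho> \<le> exp (\<epsilon> * real n) * \<rho>"
      using n1[of n] n(1) by (intro mult_right_mono) (auto simp: \<rho>_def)
    also have "\<dots> = exp (- \<epsilon> * real n)" by (simp add: \<rho>_def exp_add[symmetric])
    finally show ?thesis by simp
  qed
  finally have "\<rho> * 2 ^ card {1..n} + (1 + \<delta>) ^ q * (2 - \<delta>) ^ card {1..n} < real (card \<F>)"
    using cardF by simp
  then obtain T where T: "T \<subseteq> {1..n}" "q \<le> card ({1..n} - T)"
    "(\<Sum>S | S \<in> \<F> \<and> T \<subseteq> S. \<delta> ^ card (S - T)) \<ge> \<rho> * (1 + \<delta>) ^ card ({1..n} - T)"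
    using dense_link[of "{1..n}" \<F> \<delta> \<rho> q] F(1) \<delta> by (auto simp: \<rho>_def)
  define V where "V = {1..n} - T"
  define v where "v = card V"
  define \<G> where "\<G> = (\<lambda>S. S - T) ` {S. S \<in> \<F> \<and> T \<subseteq> S}"
  have V: "finite V" by (simp add: V_def)
  have G: "\<G> \<subseteq> Pow V" using F(1) by (auto simp: \<G>_def V_def)
  have finG: "finite \<G>" using G V by (meson finite_Pow_iff finite_subset)
  have "(\<Sum>S | S \<in> \<F> \<and> T \<subseteq> S. \<delta> ^ card (S - T)) = (\<Sum>Y\<in>\<G>. \<delta> ^ card Y)"
    unfolding \<G>_def by (subst sum.reindex) (auto intro!: inj_onI)
  also have "\<dots> = (\<Sum>m\<le>v. \<Sum>Y | Y \<in> \<G> \<and> card Y = m. \<delta> ^ card Y)"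
    using G V finG by (intro sum.group[symmetric]) (auto simp: v_def intro!: card_mono)
  also have "\<dots> = (\<Sum>m\<le>v. real (card {Y\<in>\<G>. card Y = m}) * \<delta> ^ m)"
    by (intro sum.cong) auto
  finally have layers: "\<rho> * (1 + \<delta>) ^ v \<le> (\<Sum>m\<le>v. real (card {Y\<in>\<G>. card Y = m}) * \<delta> ^ m)"
    using T(3) by (simp add: v_def V_def)
  \<comment> \<open>Only \<open>v + 1\<close> sizes occur, so some layer carries at least the
    average weight.\<close>
  obtain m where m: "\<rho> * (1 + \<delta>) ^ v / (real v + 1) \<le> real (card {Y\<in>\<G>. card Y = m}) * \<delta> ^ m"
  proof (rule ccontr)
    assume "\<not> thesis"
    then have "\<And>m. real (card {Y\<in>\<G>. card Y = m}) * \<delta> ^ m < \<rho> * (1 + \<delta>) ^ v / (real v + 1)"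
      using that by (meson not_le)
    then have "(\<Sum>m\<le>v. real (card {Y\<in>\<G>. card Y = m}) * \<delta> ^ m) <
        (\<Sum>m\<le>v. \<rho> * (1 + \<delta>) ^ v / (real v + 1))"
      by (intro sum_strict_mono) auto
    also have "\<dots> = \<rho> * (1 + \<delta>) ^ v" by (simp add: field_simps)
    finally show False using layers by simp
  qed
  have vq: "v \<ge> q" using T(2) by (simp add: v_def V_def)
  then have v: "v \<ge> n0" "v > 0" "real n \<le> 4 * real v + 3"
    using n(1) unfolding q_def by linarith+
  \<comment> \<open>Since ln (1 + \<delta>) is at least \<delta> - \<delta>^2, the target exponent
    leaves a surplus of \<delta>^2 * v, and \<open>n0\<close> was chosen so that this covers all
    losses.\<close>
  have "exp (real v * \<delta> * (1 - 2 * \<delta>)) \<le> \<rho> * (1 + \<delta>) ^ v / (real v + 1)"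
  proof -
    have "\<delta> - \<delta>\<^sup>2 \<le> ln (1 + \<delta>)" using \<delta> by (intro ln_one_plus_pos_lower_bound) auto
    then have "real v * (\<delta> - \<delta>\<^sup>2) \<le> real v * ln (1 + \<delta>)" by (intro mult_left_mono) auto
    moreover have "2 * \<epsilon> * real n \<le> 2 * \<epsilon> * (4 * real v + 3)"
      using v(3) \<epsilon> by (intro mult_left_mono) auto
    moreover have "8 * \<epsilon> * real v + 6 * \<epsilon> + ln (real v + 1) \<le> \<delta>\<^sup>2 * real v" by (rule n0) fact
    ultimately have "real v * \<delta> * (1 - 2 * \<delta>) \<le> - 2 * \<epsilon> * real n + real v * ln (1 + \<delta>) - ln (real v + 1)"
      by (simp add: algebra_simps power2_eq_square)
    then have "exp (real v * \<delta> * (1 - 2 * \<delta>)) \<le>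
        exp (- 2 * \<epsilon> * real n + real v * ln (1 + \<delta>) - ln (real v + 1))" by simp
    also have "\<dots> = \<rho> * (1 + \<delta>) ^ v / (real v + 1)"
      using \<delta> by (simp add: exp_diff exp_add exp_minus \<rho>_def exp_of_nat_mult field_simps)
    finally show ?thesis .
  qed
  also note m
  finally show thesis
    using V G v(2) union_free_subset[OF union_free_link[OF F(2), of T], of "{Y\<in>\<G>. card Y = m}"]
    by (intro that[of V "{Y\<in>\<G>. card Y = m}" m]) (auto simp: v_def \<G>_def)
qed

section \<open>Squarefree integers as sets of primes\<close>

definition primes_upto :: "nat \<Rightarrow> nat set" where
  "primes_upto N = {p. prime p \<and> p \<le> N}"

lemma finite_primes_upto [simp]: "finite (primes_upto N)"
  unfolding primes_upto_def by (rule finite_subset[of _ "{..N}"]) auto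

lemma prime_dvd_prod_primes_iff:
  fixes X :: "nat set"
  assumes "finite X" "\<And>p. p \<in> X \<Longrightarrow> prime p" "prime q"
  shows "q dvd \<Prod>X \<longleftrightarrow> q \<in> X"
proof -
  have "q dvd \<Prod>X \<longleftrightarrow> (\<exists>x\<in>X. q dvd x)" using assms(1,3) by (rule prime_dvd_prod_iff)
  also have "\<dots> \<longleftrightarrow> q \<in> X"
  proof
    assume "\<exists>x\<in>X. q dvd x"
    then obtain x where x: "x \<in> X" "q dvd x" by blast
    then have "q = x" using primes_dvd_imp_eq[OF assms(3) assms(2)] by simp
    then show "q \<in> X" using x by simp
  next
    assume "q \<in> X"
    then show "\<exists>x\<in>X. q dvd x" by (rule bexI[rotated]) simp
  qed
  finally show ?thesis .
qed

lemma inj_on_prod_primes: "inj_on (\<lambda>X. \<Prod>X) (Pow (primes_upto N))"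
proof (rule inj_onI)
  fix X Y assume XY: "X \<in> Pow (primes_upto N)" "Y \<in> Pow (primes_upto N)" "\<Prod>X = \<Prod>Y"
  have key: "q \<in> Z \<longleftrightarrow> prime q \<and> q dvd \<Prod>Z" if "Z \<in> Pow (primes_upto N)" for q Z
    using that prime_dvd_prod_primes_iff[of Z q] finite_subset[of Z "primes_upto N"]
    by (auto simp: primes_upto_def)
  show "X = Y" by (rule set_eqI) (simp only: key[OF XY(1)] key[OF XY(2)] XY(3))
qed

lemma prod_primes_pos: "X \<subseteq> primes_upto N \<Longrightarrow> \<Prod>X > 0"
  by (intro prod_pos) (auto simp: primes_upto_def prime_gt_0_nat)

lemma lcm_prod_primes:
  assumes "X \<subseteq> primes_upto N" "Y \<subseteq> primes_upto N"
  shows "lcm (\<Prod>X) (\<Prod>Y) = \<Prod>(X \<union> Y)"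
proof (rule dvd_antisym)
  have fin: "finite X" "finite Y" using assms by (auto intro: finite_subset)
  show "lcm (\<Prod>X) (\<Prod>Y) dvd \<Prod>(X \<union> Y)"
    using fin by (intro lcm_least prod_dvd_prod_subset) auto
  have "coprime (\<Prod>X) (\<Prod>(Y - X))"
    using assms by (intro prod_coprime_left prod_coprime_right primes_coprime)
      (auto simp: primes_upto_def)
  moreover have "\<Prod>(Y - X) dvd \<Prod>Y" using fin by (intro prod_dvd_prod_subset) auto
  then have "\<Prod>(Y - X) dvd lcm (\<Prod>X) (\<Prod>Y)" by (rule dvd_trans) simp
  ultimately have "\<Prod>X * \<Prod>(Y - X) dvd lcm (\<Prod>X) (\<Prod>Y)" by (intro divides_mult) auto
  also have "\<Prod>X * \<Prod>(Y - X) = \<Prod>(X \<union> (Y - X))"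
    using fin by (intro prod.union_disjoint[symmetric]) auto
  finally show "\<Prod>(X \<union> Y) dvd lcm (\<Prod>X) (\<Prod>Y)" by simp
qed

lemma square_times_prod_primes:
  assumes "n \<in> {1..N}"
  obtains s X where "s \<in> {1..N}" "X \<subseteq> primes_upto N" "n = s\<^sup>2 * \<Prod>X"
proof
  let ?r = "squarefree_part n" and ?s = "square_part n"
  have n: "n = ?r * ?s\<^sup>2" by (rule squarefree_decompose)
  have nz: "?r \<noteq> 0" "?s \<noteq> 0" using assms by auto
  have "1 \<le> ?s" using nz(2) by (metis less_one not_le)
  have "?r = (\<Prod>p\<in>prime_factors ?r. p ^ multiplicity p ?r)"
    using prod_prime_factors[OF nz(1)] by simp
  also have "\<dots> = (\<Prod>p\<in>prime_factors ?r. p)"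
    using squarefree_squarefree_part[of n] squarefree_factorial_semiring'[of ?r]
    by (intro prod.cong) auto
  finally show "n = ?s\<^sup>2 * \<Prod>(prime_factors ?r)" using n by (simp add: mult.commute)
  have "?r dvd n" "?s dvd n" using n by (metis dvd_triv_left, metis dvd_mult dvd_power zero_less_numeral)
  then show "?s \<in> {1..N}" using assms \<open>1 \<le> ?s\<close> dvd_imp_le[of ?s n] by simp
  show "prime_factors ?r \<subseteq> primes_upto N"
  proof
    fix p assume "p \<in> prime_factors ?r"
    then have "prime p" "p dvd n" using dvd_trans[OF _ \<open>?r dvd n\<close>] by (auto simp: in_prime_factors_iff)
    then show "p \<in> primes_upto N" using assms dvd_imp_le[of p n] by (simp add: primes_upto_def)
  qed
qed

section \<open>Reciprocal sums over integers, square parts and primes\<close>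

lemma sum_inverse_squares_le: "(\<Sum>s=1..N. 1 / (real s)\<^sup>2) \<le> 2"
proof -
  \<comment> \<open>Subtracting \<open>1 / real (Suc n)\<close> strengthens the bound so that the
    induction telescopes.\<close>
  have "(\<Sum>s=1..Suc n. 1 / (real s)\<^sup>2) \<le> 2 - 1 / real (Suc n)" for n
  proof (induction n)
    case (Suc n)
    have "1 / (real (Suc (Suc n)))\<^sup>2 \<le> 1 / (real (Suc n) * real (Suc (Suc n)))"
      by (intro divide_left_mono) (auto simp: power2_eq_square)
    also have "\<dots> = 1 / real (Suc n) - 1 / real (Suc (Suc n))" by (simp add: field_simps)
    finally show ?case using Suc.IH by simp
  qed simp
  then show ?thesis
    by (cases N) (simp, smt (verit) of_nat_0_le_iff zero_le_divide_1_iff)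
qed

text \<open>As the weights \<open>1 / s^2\<close> add up to at most 2, some inner sum is at least
  half of the left side. The same inequality with \<open>A = {1..N}\<close> bounds the harmonic sum
  by an Euler product.\<close>

lemma sum_inverse_square_decomposition:
  assumes "A \<subseteq> {1..N}"
  shows "(\<Sum>a\<in>A. 1 / real a) \<le>
    (\<Sum>s=1..N. 1 / (real s)\<^sup>2 * (\<Sum>X | X \<subseteq> primes_upto N \<and> s\<^sup>2 * \<Prod>X \<in> A. 1 / real (\<Prod>X)))"
proof -
  let ?D = "SIGMA s:{1..N}. {X. X \<subseteq> primes_upto N \<and> s\<^sup>2 * \<Prod>X \<in> A}"
  let ?h = "\<lambda>(s, X). s\<^sup>2 * \<Prod>X :: nat"
  have finX: "finite {X. X \<subseteq> primes_upto N \<and> s\<^sup>2 * \<Prod>X \<in> A}" for s :: nat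
    by (rule finite_subset[of _ "Pow (primes_upto N)"]) auto
  then have fin: "finite ?D" by (intro finite_SigmaI) auto
  have "A \<subseteq> ?h ` ?D"
  proof
    fix a assume "a \<in> A"
    then obtain s X where "s \<in> {1..N}" "X \<subseteq> primes_upto N" "a = s\<^sup>2 * \<Prod>X"
      using square_times_prod_primes assms by blast
    then show "a \<in> ?h ` ?D" using \<open>a \<in> A\<close> by (intro image_eqI[of _ _ "(s, X)"]) auto
  qed
  then have "(\<Sum>a\<in>A. 1 / real a) \<le> (\<Sum>a\<in>?h ` ?D. 1 / real a)"
    using fin by (intro sum_mono2) auto
  also have "\<dots> \<le> (\<Sum>z\<in>?D. 1 / real (?h z))"
    using sum_image_le[OF fin, of "\<lambda>a. 1 / real a" ?h] by (simp add: o_def)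
  also have "\<dots> = (\<Sum>s=1..N. \<Sum>X | X \<subseteq> primes_upto N \<and> s\<^sup>2 * \<Prod>X \<in> A. 1 / real (s\<^sup>2 * \<Prod>X))"
    using finX by (subst sum.Sigma) (auto intro!: sum.cong)
  also have "\<dots> = (\<Sum>s=1..N. 1 / (real s)\<^sup>2 *
      (\<Sum>X | X \<subseteq> primes_upto N \<and> s\<^sup>2 * \<Prod>X \<in> A. 1 / real (\<Prod>X)))"
    by (simp add: sum_distrib_left)
  finally show ?thesis .
qed

text \<open>The factor \<open>s^2\<close> comes out of every LCM, and the LCM of two products of
  distinct primes is the product over the union of the prime sets.\<close>

lemma union_free_of_lcm_free:
  assumes "lcm_free k A" "s > 0"
  shows "union_free k {X. X \<subseteq> primes_upto N \<and> s\<^sup>2 * \<Prod>X \<in> A}"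
proof (rule union_freeI)
  fix S U assume S: "inj_on S {1..k}" "equal_unions k S U"
    and "\<And>i. i \<in> {1..k} \<Longrightarrow> S i \<in> {X. X \<subseteq> primes_upto N \<and> s\<^sup>2 * \<Prod>X \<in> A}"
  then have mem: "\<And>i. i \<in> {1..k} \<Longrightarrow> S i \<subseteq> primes_upto N \<and> s\<^sup>2 * \<Prod>(S i) \<in> A" by simp
  let ?a = "\<lambda>i. s\<^sup>2 * \<Prod>(S i)"
  have "inj_on ?a {1..k}"
  proof (rule inj_onI)
    fix i j assume ij: "i \<in> {1..k}" "j \<in> {1..k}" "?a i = ?a j"
    then have "\<Prod>(S i) = \<Prod>(S j)" using assms(2) by simp
    then have "S i = S j" using inj_onD[OF inj_on_prod_primes] mem ij(1,2) by blast
    then show "i = j" using inj_onD[OF S(1)] ij by blast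
  qed
  moreover have "lcm (?a i) (?a j) = s\<^sup>2 * \<Prod>U" if "1 \<le> i" "i < j" "j \<le> k" for i j
  proof -
    have ij: "i \<in> {1..k}" "j \<in> {1..k}" "i \<noteq> j" using that by auto
    have "lcm (?a i) (?a j) = s\<^sup>2 * lcm (\<Prod>(S i)) (\<Prod>(S j))" by (simp add: lcm_mult_left)
    also have "\<dots> = s\<^sup>2 * \<Prod>(S i \<union> S j)" using mem[OF ij(1)] mem[OF ij(2)] by (subst lcm_prod_primes) auto
    finally show ?thesis using equal_unionsD[OF S(2) ij] by simp
  qed
  moreover have "?a ` {1..k} \<subseteq> A" using mem by auto
  ultimately show False using assms(1) unfolding lcm_free_def by blast
qed

text \<open>Euler's argument: splitting off squares bounds the harmonic sum by twice the product of
  the factors \<open>1 + 1 / p\<close>, and each factor is at most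
  \<open>exp (1 / p)\<close>.\<close>

lemma sum_inverse_primes_ge:
  assumes "N \<ge> 1"
  shows "(\<Sum>p\<in>primes_upto N. 1 / real p) \<ge> ln (ln (real N + 1) / 2)"
proof -
  let ?P = "primes_upto N"
  have pow: "(\<Sum>X\<in>Pow ?P. 1 / real (\<Prod>X)) = (\<Prod>p\<in>?P. 1 + 1 / real p)"
    using sum_Pow_prod[of ?P "\<lambda>p. 1 / real p" "\<lambda>_. 1"] by (simp add: prod_dividef add.commute)
  have "ln (real N + 1) \<le> (\<Sum>a\<in>{1..N}. 1 / real a)"
    using ln_le_harm[of N] by (simp add: harm_def inverse_eq_divide)
  also have "\<dots> \<le> (\<Sum>s=1..N. 1 / (real s)\<^sup>2 *
      (\<Sum>X | X \<subseteq> ?P \<and> s\<^sup>2 * \<Prod>X \<in> {1..N}. 1 / real (\<Prod>X)))"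
    by (rule sum_inverse_square_decomposition) simp
  also have "\<dots> \<le> (\<Sum>s=1..N. 1 / (real s)\<^sup>2 * (\<Sum>X\<in>Pow ?P. 1 / real (\<Prod>X)))"
    by (intro sum_mono mult_left_mono sum_mono2) (auto intro!: prod_nonneg)
  also have "\<dots> = (\<Sum>s=1..N. 1 / (real s)\<^sup>2) * (\<Prod>p\<in>?P. 1 + 1 / real p)"
    unfolding pow sum_distrib_right ..
  also have "\<dots> \<le> 2 * (\<Prod>p\<in>?P. 1 + 1 / real p)"
    by (intro mult_right_mono sum_inverse_squares_le prod_nonneg) auto
  also have "(\<Prod>p\<in>?P. 1 + 1 / real p) \<le> (\<Prod>p\<in>?P. exp (1 / real p))"
    by (intro prod_mono) auto
  also have "\<dots> = exp (\<Sum>p\<in>?P. 1 / real p)" by (simp add: exp_sum)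
  finally have "ln (real N + 1) / 2 \<le> exp (\<Sum>p\<in>?P. 1 / real p)" by simp
  moreover have "ln (real N + 1) / 2 > 0" using assms by simp
  ultimately show ?thesis by (metis ln_exp ln_le_cancel_iff exp_gt_zero)
qed

text \<open>A discrete integral comparison: every term after the first is at most the increment of
  \<open>- (n powr (- t)) / t\<close>, and the increments telescope.\<close>

lemma sum_powr_le:
  fixes t :: real
  assumes "t > 0"
  shows "(\<Sum>n=1..M. real n powr (- (1 + t))) \<le> 1 + 1 / t"
proof -
  have "(\<Sum>n=1..Suc m. real n powr (- (1 + t))) \<le> 1 + (1 - real (Suc m) powr (- t)) / t" for m
  proof (induction m)
    case (Suc m)
    define a where "a = real (Suc m)"
    have a: "a > 0" by (simp add: a_def)
    \<comment> \<open>This and the next estimate give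
      \<open>1 + t / (a + 1) \<le> ((a + 1) / a) powr t\<close>, first by
      \<open>ln y \<le> y - 1\<close> and then by \<open>1 + y \<le> exp y\<close>.\<close>
    have "1 + t / (a + 1) \<le> 1 + t * ln ((a + 1) / a)"
    proof -
      have "ln (a / (a + 1)) \<le> a / (a + 1) - 1" using a by (intro ln_le_minus_one) auto
      then have "1 / (a + 1) \<le> ln ((a + 1) / a)" using a by (simp add: ln_div field_simps)
      then have "t * (1 / (a + 1)) \<le> t * ln ((a + 1) / a)" using assms by (intro mult_left_mono) auto
      then show ?thesis by simp
    qed
    also have "\<dots> \<le> ((a + 1) / a) powr t"
      using a by (simp add: powr_def)
    finally have "(a + 1) powr (- t) * (1 + t / (a + 1)) \<le> (a + 1) powr (- t) * ((a + 1) / a) powr t"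
      by (intro mult_left_mono) auto
    also have "\<dots> = a powr (- t)" using a by (simp add: powr_divide powr_minus field_simps)
    finally have "(a + 1) powr (- t) * (t / (a + 1)) \<le> a powr (- t) - (a + 1) powr (- t)"
      by (simp add: algebra_simps)
    moreover have "(a + 1) powr (- t) * (t / (a + 1)) = t * (a + 1) powr (- (1 + t))"
      using a by (simp add: powr_diff powr_minus field_simps)
    ultimately have "(a + 1) powr (- (1 + t)) \<le> (a powr (- t) - (a + 1) powr (- t)) / t"
      using assms by (simp add: field_simps)
    moreover have "real (Suc (Suc m)) = a + 1" by (simp add: a_def)
    ultimately have "real (Suc (Suc m)) powr (- (1 + t)) \<le>
        (1 - real (Suc (Suc m)) powr (- t)) / t - (1 - real (Suc m) powr (- t)) / t"
      unfolding a_def by (simp add: diff_divide_distrib)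
    then show ?case using Suc.IH by simp
  qed simp
  moreover have "1 + (1 - real (Suc m) powr (- t)) / t \<le> 1 + 1 / t" for m
    using assms by (simp add: divide_right_mono)
  ultimately have "(\<Sum>n=1..Suc m. real n powr (- (1 + t))) \<le> 1 + 1 / t" for m
    using order_trans by blast
  then show ?thesis using assms by (cases M) auto
qed

text \<open>The expanded product is a sum over distinct squarefree integers, hence part of the sum
  over all positive integers.\<close>

lemma prod_primes_powr_le:
  fixes t :: real
  assumes "t > 0"
  shows "(\<Prod>p\<in>primes_upto N. 1 + real p powr (- (1 + t))) \<le> 1 + 1 / t"
proof -
  let ?P = "primes_upto N"
  have "(\<Prod>p\<in>?P. 1 + real p powr (- (1 + t))) = (\<Sum>X\<in>Pow ?P. \<Prod>p\<in>X. real p powr (- (1 + t)))"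
    using sum_Pow_prod[of ?P "\<lambda>p. real p powr (- (1 + t))" "\<lambda>_. 1"] by (simp add: add.commute)
  also have "\<dots> = (\<Sum>X\<in>Pow ?P. real (\<Prod>X) powr (- (1 + t)))"
    by (intro sum.cong refl) (simp add: prod_powr_distrib)
  also have "\<dots> = (\<Sum>n\<in>(\<lambda>X. \<Prod>X) ` Pow ?P. real n powr (- (1 + t)))"
    by (subst sum.reindex[OF inj_on_prod_primes]) simp
  also have "\<dots> \<le> (\<Sum>n=1..Max ((\<lambda>X. \<Prod>X) ` Pow ?P). real n powr (- (1 + t)))"
    using prod_primes_pos by (intro sum_mono2) (force simp: Suc_le_eq)+
  also have "\<dots> \<le> 1 + 1 / t" by (rule sum_powr_le) fact
  finally show ?thesis .
qed

section \<open>From LCM-free sets to sunflower-free families\<close>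

lemma lcm_free_max_ge:
  assumes "A \<subseteq> {1..N}" "lcm_free k A"
  shows "(\<Sum>a\<in>A. 1 / real a) \<le> lcm_free_max k N"
  unfolding lcm_free_max_def by (rule Max_ge[OF finite_lcm_free_sums]) (use assms in blast)

lemma obtain_lcm_free_max:
  assumes "k \<ge> 1"
  obtains A where "A \<subseteq> {1..N}" "lcm_free k A" "(\<Sum>a\<in>A. 1 / real a) = lcm_free_max k N"
proof -
  let ?M = "{(\<Sum>a\<in>A. 1 / real a) | A. A \<subseteq> {1..N} \<and> lcm_free k A}"
  have "(\<Sum>a\<in>{}. 1 / real a) \<in> ?M" using lcm_free_empty[OF assms] by blast
  then have "?M \<noteq> {}" by blast
  then have "Max ?M \<in> ?M" by (rule Max_in[OF finite_lcm_free_sums])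
  then obtain A where "A \<subseteq> {1..N}" "lcm_free k A" "(\<Sum>a\<in>A. 1 / real a) = Max ?M"
    unfolding mem_Collect_eq by metis
  then show thesis using that unfolding lcm_free_max_def by blast
qed

text \<open>The constant 12 collects a factor 2 from fixing the square part, 3 from replacing
  \<open>1 / p\<close> by the biased weights, and 2 from the averaging in
  \<open>dense_on_large_subset\<close>.\<close>

lemma sunflower_free_max_ge_of_lcm_free_max:
  assumes k: "k \<ge> 2" and N: "N \<ge> 2" and f: "lcm_free_max k N > 12 * 2 ^ n"
  shows "\<exists>q\<ge>n. 2 ^ q * lcm_free_max k N \<le> 12 * (1 + ln (real N)) * real (sunflower_free_max k q)"
proof -
  define f where "f = lcm_free_max k N"
  have fpos: "f > 12 * 2 ^ n" using f by (simp add: f_def)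
  have fpos': "f > 0" using fpos zero_less_power[of "2::real" n] by linarith
  obtain A where A: "A \<subseteq> {1..N}" "lcm_free k A" "(\<Sum>a\<in>A. 1 / real a) = f"
    using obtain_lcm_free_max[of k N] k unfolding f_def by (metis le_trans one_le_numeral)
  define \<B> where "\<B> s = {X. X \<subseteq> primes_upto N \<and> s\<^sup>2 * \<Prod>X \<in> A}" for s :: nat
  have "\<exists>s\<in>{1..N}. f / 2 \<le> (\<Sum>X\<in>\<B> s. 1 / real (\<Prod>X))"
  proof (rule ccontr)
    assume "\<not> ?thesis"
    then have less: "(\<Sum>X\<in>\<B> s. 1 / real (\<Prod>X)) < f / 2" if "s \<in> {1..N}" for s
      using that by (meson not_le)
    have "f \<le> (\<Sum>s=1..N. 1 / (real s)\<^sup>2 * (\<Sum>X\<in>\<B> s. 1 / real (\<Prod>X)))"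
      using sum_inverse_square_decomposition[OF A(1)] unfolding A(3) \<B>_def .
    also have "\<dots> < (\<Sum>s=1..N. 1 / (real s)\<^sup>2 * (f / 2))"
      using N less by (intro sum_strict_mono mult_strict_left_mono) auto
    also have "\<dots> = (\<Sum>s=1..N. 1 / (real s)\<^sup>2) * (f / 2)" by (simp only: sum_distrib_right)
    also have "\<dots> \<le> 2 * (f / 2)" using fpos' by (intro mult_right_mono sum_inverse_squares_le) simp
    finally show False by simp
  qed
  then obtain s where s: "s \<in> {1..N}" "f / 2 \<le> (\<Sum>X\<in>\<B> s. 1 / real (\<Prod>X))" by blast
  \<comment> \<open>For \<open>1 \<le> y \<le> N\<close> this exponent makes
    \<open>y powr (- t)\<close> at least \<open>1 / exp 1\<close>, hence at least 1/3, while the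
    Euler product stays below \<open>1 + ln N\<close>.\<close>
  define t where "t = 1 / ln (real N)"
  have t: "t > 0" "t * ln (real N) = 1" using N by (auto simp: t_def)
  define x where "x p = real p powr (- (1 + t))" for p :: nat
  define W where "W = (\<Sum>X\<in>\<B> s. prod x X)"
  have x: "1 / real (\<Prod>X) \<le> 3 * prod x X" if "X \<in> \<B> s" for X
  proof -
    have X: "X \<subseteq> primes_upto N" "s\<^sup>2 * \<Prod>X \<in> A" using that by (auto simp: \<B>_def)
    have pos: "\<Prod>X > 0" using prod_primes_pos[OF X(1)] .
    have "1 * \<Prod>X \<le> s\<^sup>2 * \<Prod>X" using s(1) by (intro mult_right_mono) auto
    also have "\<dots> \<le> N" using X(2) A(1) by auto
    finally have le: "real (\<Prod>X) \<le> real N" by (simp only: of_nat_le_iff mult_1)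
    define y where "y = real (\<Prod>X)"
    have y: "0 < y" "y \<le> real N" using pos le by (simp_all only: y_def of_nat_0_less_iff)
    have "ln y \<le> ln (real N)" using y by simp
    then have "t * ln y \<le> 1" using t mult_left_mono[of "ln y" "ln (real N)" t] by simp
    then have "exp (t * ln y) \<le> exp 1" by simp
    also have "\<dots> \<le> 3" by (rule exp_le)
    finally have le3: "exp (t * ln y) \<le> 3" .
    have "y powr (- (1 + t)) = exp (- (ln y + t * ln y))" using y by (simp add: powr_def algebra_simps)
    also have "\<dots> = 1 / (y * exp (t * ln y))"
      using y by (subst exp_minus) (simp add: exp_add inverse_eq_divide)
    finally have eq: "y powr (- (1 + t)) = 1 / (y * exp (t * ln y))" .
    have "1 / y \<le> 3 * y powr (- (1 + t))" unfolding eq using le3 y by (simp add: field_simps)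
    also have "y powr (- (1 + t)) = prod x X"
      unfolding y_def x_def by (simp add: prod_powr_distrib)
    finally show ?thesis unfolding y_def .
  qed
  have "f / 2 \<le> (\<Sum>X\<in>\<B> s. 3 * prod x X)" using s(2) sum_mono[OF x] by (rule order_trans)
  also have "\<dots> = 3 * W" by (simp add: W_def sum_distrib_left)
  finally have W: "f \<le> 6 * W" by simp
  then have "W > 2 ^ (n + 1)" using fpos by simp
  moreover have "0 \<le> x p \<and> x p \<le> 1" if "p \<in> primes_upto N" for p
  proof -
    have "real p powr (- (1 + t)) \<le> real p powr 0"
      using that t prime_ge_1_nat[of p] by (intro powr_mono) (auto simp: primes_upto_def)
    then show ?thesis using that by (auto simp: x_def primes_upto_def)
  qed
  ultimately obtain Q where Q: "Q \<subseteq> primes_upto N" "n \<le> card Q"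
    "2 ^ card Q * W \<le> 2 * real (card {X\<in>\<B> s. X \<subseteq> Q}) * (\<Prod>p\<in>primes_upto N. 1 + x p)"
    using dense_on_large_subset[of "primes_upto N" x "\<B> s" W n] by (auto simp: W_def \<B>_def)
  have "union_free k (\<B> s)" unfolding \<B>_def using A(2) s(1) by (intro union_free_of_lcm_free) auto
  then have "union_free k {X\<in>\<B> s. X \<subseteq> Q}" by (rule union_free_subset) auto
  then have card: "card {X\<in>\<B> s. X \<subseteq> Q} \<le> sunflower_free_max k (card Q)"
    using Q(1) k by (intro card_le_sunflower_free_max) (auto intro: finite_subset)
  have "2 ^ card Q * f \<le> 6 * (2 ^ card Q * W)" using W by simp
  also have "\<dots> \<le> 6 * (2 * real (card {X\<in>\<B> s. X \<subseteq> Q}) * (\<Prod>p\<in>primes_upto N. 1 + x p))"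
    using Q(3) by (rule mult_left_mono) simp
  also have "\<dots> \<le> 6 * (2 * real (sunflower_free_max k (card Q)) * (1 + ln (real N)))"
  proof -
    have "(\<Prod>p\<in>primes_upto N. 1 + x p) \<le> 1 + ln (real N)"
      using prod_primes_powr_le[OF t(1)] by (simp add: x_def t_def)
    then show ?thesis
      using card by (intro mult_left_mono mult_mono) (auto simp: x_def intro!: prod_nonneg)
  qed
  finally show ?thesis using Q(2) by (intro exI[of _ "card Q"]) (simp add: f_def algebra_simps)
qed

lemma sunflower_capacity_le: "k \<ge> 2 \<Longrightarrow> sunflower_capacity k \<le> 2"
proof -
  assume k: "k \<ge> 2"
  have "real (sunflower_free_max k n) powr (1 / real n) \<le> 2" if "n \<ge> 1" for n
  proof -
    have "real (sunflower_free_max k n) \<le> 2 ^ n"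
      using sunflower_free_max_le[OF k, of n] by (metis of_nat_le_iff of_nat_numeral of_nat_power)
    then have "real (sunflower_free_max k n) powr (1 / real n) \<le> (2 ^ n) powr (1 / real n)"
      by (intro powr_mono2) auto
    also have "\<dots> = 2" using that by (simp add: powr_realpow[symmetric] powr_powr)
    finally show ?thesis .
  qed
  then have "\<forall>\<^sub>F n in sequentially. ereal (real (sunflower_free_max k n) powr (1 / real n)) \<le> 2"
    by (auto simp: eventually_sequentially intro!: exI[of _ 1])
  then show ?thesis unfolding sunflower_capacity_def by (rule Limsup_bounded)
qed

text \<open>A capacity below 2 would force an exponential loss \<open>exp (- \<delta> * q)\<close>
  against \<open>2 ^ q\<close> for all large \<open>q\<close>. The preceding transfer yields some
  \<open>q\<close> of order at least \<open>ln (ln N)\<close> with a loss of only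
  \<open>24 * ln N powr \<epsilon> N\<close>, which is smaller.\<close>

lemma sunflower_capacity_eq_2I:
  fixes \<epsilon> :: "nat \<Rightarrow> real"
  assumes k: "k \<ge> 2" and \<epsilon>: "\<epsilon> \<longlonglongrightarrow> 0"
    and f: "\<forall>\<^sub>F N in sequentially. lcm_free_max k N = ln (real N) powr (1 - \<epsilon> N)"
  shows "sunflower_capacity k = 2"
proof (rule ccontr)
  assume "sunflower_capacity k \<noteq> 2"
  then have "sunflower_capacity k < 2" using sunflower_capacity_le[OF k] by simp
  then obtain y :: real where y: "sunflower_capacity k < ereal y" "ereal y < 2"
    using ereal_dense2 by blast
  \<comment> \<open>Raising \<open>y\<close> to at least 1 keeps it a bound for the capacity and
    makes \<open>ln (2 / z)\<close> and the powers of \<open>z\<close> unproblematic.\<close>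
  define z where "z = max 1 y"
  have z: "1 \<le> z" "z < 2" using y(2) by (auto simp: z_def)
  have "sunflower_capacity k < ereal z" using y(1) by (rule order.strict_trans2) (simp add: z_def)
  then have "\<forall>\<^sub>F n in sequentially. ereal (real (sunflower_free_max k n) powr (1 / real n)) < ereal z"
    unfolding sunflower_capacity_def by (rule Limsup_lessD)
  then obtain q0 where q0:
    "\<And>q. q \<ge> q0 \<Longrightarrow> real (sunflower_free_max k q) powr (1 / real q) < z"
    by (auto simp: eventually_sequentially)
  define \<delta> where "\<delta> = ln (2 / z)"
  have \<delta>: "\<delta> > 0" "z = 2 * exp (- \<delta>)" using z by (auto simp: \<delta>_def exp_minus)
  define L where "L N = ln (ln (real N))" for N :: nat
  have "filterlim L at_top sequentially" unfolding L_def by real_asymp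
  then have "\<forall>\<^sub>F N in sequentially. L N > max (max (2 * real q0 + 2) (4 * ln 12)) ((ln 24 + \<delta>) * 4 / \<delta>)"
    by (rule filterlim_at_top_dense[THEN iffD1, rule_format])
  moreover have "\<forall>\<^sub>F N in sequentially. \<bar>\<epsilon> N\<bar> < min (1 / 4) (\<delta> / 4)"
    using \<epsilon>[unfolded tendsto_iff, rule_format, of "min (1 / 4) (\<delta> / 4)"] \<delta> by simp
  moreover have "\<forall>\<^sub>F N in sequentially. N \<ge> (3::nat)" by (rule eventually_ge_at_top)
  ultimately have "\<forall>\<^sub>F N in sequentially. False"
    using f
  proof eventually_elim
    case (elim N)
    then have Lq: "L N > 2 * real q0 + 2" and L12: "L N > 4 * ln 12"
      and L24: "L N > (ln 24 + \<delta>) * 4 / \<delta>" and e: "\<epsilon> N < 1 / 4" "\<epsilon> N < \<delta> / 4"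
      and N: "N \<ge> 3" and f: "lcm_free_max k N = ln (real N) powr (1 - \<epsilon> N)"
      by auto
    have L0: "L N > 0" using Lq by simp
    have lnN: "ln (real N) > 0" using N by simp
    have expL: "exp (L N) = ln (real N)" using lnN by (simp add: L_def)
    have lnN1: "ln (real N) \<ge> 1" using L0 expL by (metis one_le_exp_iff less_imp_le)
    have f': "lcm_free_max k N = exp ((1 - \<epsilon> N) * L N)"
      using lnN f by (simp add: powr_def L_def)
    \<comment> \<open>Half of \<open>L N\<close> is a compromise: \<open>2 ^ n\<close> stays below
      \<open>exp (L N / 2)\<close>, well under \<open>lcm_free_max k N\<close>, while
      \<open>\<delta> * n\<close> is about \<open>\<delta> * L N / 2\<close> and beats the loss
      \<open>\<epsilon> N * L N\<close>, which is below \<open>\<delta> * L N / 4\<close>.\<close>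
    define n where "n = nat \<lfloor>L N / 2\<rfloor>"
    have n: "real n \<le> L N / 2" "real n > L N / 2 - 1" using L0 unfolding n_def by linarith+
    have nq: "n \<ge> q0" "n \<ge> 1" using n(2) Lq by linarith+
    have "12 * 2 ^ n \<le> 12 * exp (1::real) ^ n"
      using exp_ge_add_one_self[of "1::real"] by (intro mult_left_mono power_mono) auto
    also have "\<dots> = exp (ln 12 + real n)" by (simp add: exp_add exp_of_nat_mult[symmetric])
    also have "\<dots> < exp ((1 - \<epsilon> N) * L N)"
    proof -
      have "\<epsilon> N * L N \<le> 1 / 4 * L N" using e L0 by (intro mult_right_mono) auto
      then show ?thesis using n(1) L12 by (simp add: algebra_simps)
    qed
    finally have "lcm_free_max k N > 12 * 2 ^ n" unfolding f' .
    then obtain q where q: "q \<ge> n"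
      "2 ^ q * lcm_free_max k N \<le> 12 * (1 + ln (real N)) * real (sunflower_free_max k q)"
      using sunflower_free_max_ge_of_lcm_free_max[OF k, of N n] N by auto
    have "exp (ln 24 + L N - \<delta> * real q) \<le> exp ((1 - \<epsilon> N) * L N)"
    proof -
      have "\<delta> * (L N / 2 - 1) \<le> \<delta> * real q" using \<delta> q(1) n(2) by (intro mult_left_mono) auto
      moreover have "\<epsilon> N * L N \<le> \<delta> / 4 * L N" using e L0 by (intro mult_right_mono) auto
      moreover have "ln 24 + \<delta> < \<delta> / 4 * L N" using L24 \<delta> by (simp add: field_simps)
      ultimately show ?thesis by (simp add: algebra_simps)
    qed
    then have "24 * ln (real N) * exp (- \<delta> * real q) \<le> lcm_free_max k N"
      unfolding f' by (simp add: exp_add exp_diff expL exp_minus field_simps)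
    then have "2 ^ q * (24 * ln (real N) * exp (- \<delta> * real q)) \<le> 2 ^ q * lcm_free_max k N"
      by (intro mult_left_mono) auto
    also have "\<dots> \<le> 24 * ln (real N) * real (sunflower_free_max k q)"
      using q(2) mult_right_mono[OF lnN1, of "real (sunflower_free_max k q)"] by (simp add: algebra_simps)
    finally have "2 ^ q * exp (- \<delta> * real q) \<le> real (sunflower_free_max k q)"
      using lnN by (simp add: field_simps)
    moreover have "2 ^ q * exp (- \<delta> * real q) = z ^ q"
      unfolding \<delta>(2) by (simp add: power_mult_distrib exp_of_nat_mult[symmetric] mult.commute)
    ultimately have "(z ^ q) powr (1 / real q) \<le> real (sunflower_free_max k q) powr (1 / real q)"
      using z by (intro powr_mono2) auto
    moreover have "(z ^ q) powr (1 / real q) = z"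
      using z q(1) nq by (simp add: powr_realpow[symmetric] powr_powr)
    ultimately show False using q0[of q] q(1) nq by simp
  qed
  then show False by simp
qed

section \<open>From sunflower-free families to LCM-free sets\<close>

lemma subset_sum_between:
  fixes w :: "'a \<Rightarrow> real"
  assumes "finite X" "\<And>x. x \<in> X \<Longrightarrow> w x \<le> \<eta>" "\<delta> \<le> sum w X" "0 \<le> \<delta>" "0 \<le> \<eta>"
  shows "\<exists>Y\<subseteq>X. \<delta> \<le> sum w Y \<and> sum w Y \<le> \<delta> + \<eta>"
  using assms
proof (induction X rule: finite_induct)
  case (insert x X)
  show ?case
  proof (cases "\<delta> \<le> sum w X")
    case True
    then show ?thesis using insert by (meson insertI2 subset_insertI2)
  next
    case False
    moreover have "w x \<le> \<eta>" using insert.prems(1) by simp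
    ultimately have "sum w (insert x X) \<le> \<delta> + \<eta>" using insert.hyps by simp
    then show ?thesis using insert.prems by blast
  qed
qed auto

text \<open>Groups are cut off one after another. No element weighs more than \<eta>, so a group
  reaching weight \<delta> can be chosen to use up at most \<delta> + \<eta>.\<close>

lemma disjoint_groups:
  fixes w :: "'a \<Rightarrow> real"
  assumes "finite I" "finite X" "\<And>x. x \<in> X \<Longrightarrow> w x \<le> \<eta>"
    "real (card I) * (\<delta> + \<eta>) \<le> sum w X" "0 \<le> \<delta>" "0 \<le> \<eta>"
  shows "\<exists>Q. (\<forall>i\<in>I. Q i \<subseteq> X \<and> \<delta> \<le> sum w (Q i)) \<and> disjoint_family_on Q I"
  using assms
proof (induction I arbitrary: X rule: finite_induct)
  case (insert i I)
  have "0 \<le> real (card I) * (\<delta> + \<eta>)" using insert.prems by simp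
  moreover have "real (card (insert i I)) * (\<delta> + \<eta>) = real (card I) * (\<delta> + \<eta>) + (\<delta> + \<eta>)"
    using insert.hyps by (simp add: algebra_simps)
  ultimately have ge: "real (card I) * (\<delta> + \<eta>) + (\<delta> + \<eta>) \<le> sum w X" "\<delta> \<le> sum w X"
    using insert.prems by linarith+
  obtain Y where Y: "Y \<subseteq> X" "\<delta> \<le> sum w Y" "sum w Y \<le> \<delta> + \<eta>"
    using subset_sum_between[of X w \<eta> \<delta>] insert.prems ge by blast
  have "sum w (X - Y) = sum w X - sum w Y" using Y(1) insert.prems by (intro sum_diff) auto
  then have "real (card I) * (\<delta> + \<eta>) \<le> sum w (X - Y)" using ge Y by linarith
  then have "\<exists>Q. (\<forall>i\<in>I. Q i \<subseteq> X - Y \<and> \<delta> \<le> sum w (Q i)) \<and> disjoint_family_on Q I"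
    using insert.prems by (intro insert.IH) auto
  then obtain Q where Q: "\<forall>i\<in>I. Q i \<subseteq> X - Y \<and> \<delta> \<le> sum w (Q i)" "disjoint_family_on Q I" by blast
  have "disjoint_family_on (Q(i := Y)) (insert i I)"
    unfolding disjoint_family_on_def
  proof (intro ballI impI)
    fix a b assume ab: "a \<in> insert i I" "b \<in> insert i I" "a \<noteq> b"
    have "Q c \<inter> Y = {}" if "c \<in> I" for c using Q(1) that by blast
    then show "(Q(i := Y)) a \<inter> (Q(i := Y)) b = {}"
      using ab Q(2) unfolding disjoint_family_on_def by (cases "a = i"; cases "b = i") auto
  qed
  moreover have "\<forall>j\<in>insert i I. (Q(i := Y)) j \<subseteq> X \<and> \<delta> \<le> sum w ((Q(i := Y)) j)"
    using Q(1) Y insert.hyps by auto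
  ultimately show ?case by blast
qed (simp add: disjoint_family_on_def)

lemma prod_sum_PiE:
  fixes f :: "'b \<Rightarrow> 'c::comm_semiring_1"
  assumes "finite S" "\<And>j. j \<in> S \<Longrightarrow> finite (Q j)"
  shows "(\<Prod>j\<in>S. sum f (Q j)) = (\<Sum>c\<in>Pi\<^sub>E S Q. \<Prod>j\<in>S. f (c j))"
  using assms
proof (induction S rule: finite_induct)
  case (insert i S)
  have "(\<Sum>c\<in>Pi\<^sub>E (insert i S) Q. \<Prod>j\<in>insert i S. f (c j)) =
      (\<Sum>(y, c)\<in>Q i \<times> Pi\<^sub>E S Q. \<Prod>j\<in>insert i S. f ((c(i := y)) j))"
    unfolding PiE_insert_eq using insert.hyps
    by (subst sum.reindex[OF inj_combinator]) (auto simp: case_prod_unfold)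
  also have "\<dots> = (\<Sum>(y, c)\<in>Q i \<times> Pi\<^sub>E S Q. f y * (\<Prod>j\<in>S. f (c j)))"
  proof (intro sum.cong refl, clarify)
    fix y c
    have "(\<Prod>j\<in>S. f ((c(i := y)) j)) = (\<Prod>j\<in>S. f (c j))"
      using insert.hyps by (intro prod.cong) auto
    then show "(\<Prod>j\<in>insert i S. f ((c(i := y)) j)) = f y * (\<Prod>j\<in>S. f (c j))"
      using insert.hyps by simp
  qed
  also have "\<dots> = sum f (Q i) * (\<Sum>c\<in>Pi\<^sub>E S Q. \<Prod>j\<in>S. f (c j))"
    by (simp add: sum_product sum.cartesian_product)
  finally show ?case using insert by simp
qed simp

section \<open>Integers built from transversals of disjoint prime groups\<close>

locale prime_groups =
  fixes V :: "'i set" and Q :: "'i \<Rightarrow> nat set" and \<F> :: "'i set set" and Y :: nat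
  assumes finV: "finite V" and FV: "\<F> \<subseteq> Pow V" and disj: "disjoint_family_on Q V"
    and primeQ: "\<And>j p. j \<in> V \<Longrightarrow> p \<in> Q j \<Longrightarrow> prime p \<and> p \<le> Y"
begin

text \<open>Functions in \<open>Pi\<^sub>E\<close> are \<open>undefined\<close> off
  \<open>S\<close>, so a pair is determined by \<open>S\<close> and the primes chosen on
  \<open>S\<close>; this is what makes \<open>pr\<close> injective.\<close>

definition transversals :: "('i set \<times> ('i \<Rightarrow> nat)) set" where
  "transversals = (SIGMA S:\<F>. Pi\<^sub>E S Q)"

definition pr :: "'i set \<times> ('i \<Rightarrow> nat) \<Rightarrow> nat" where
  "pr = (\<lambda>(S, c). \<Prod>j\<in>S. c j)"

lemma finite_Q: "j \<in> V \<Longrightarrow> finite (Q j)"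
  using primeQ by (intro finite_subset[of "Q j" "{..Y}"]) auto

lemma finite_F: "finite \<F>" "S \<in> \<F> \<Longrightarrow> finite S"
  using FV finV by (meson finite_Pow_iff finite_subset, auto intro: finite_subset)

lemma transversalD:
  assumes "(S, c) \<in> transversals" "j \<in> S"
  shows "j \<in> V" "c j \<in> Q j" "prime (c j)" "c j \<le> Y"
  using assms FV primeQ[of j "c j"] by (auto simp: transversals_def)

lemma prime_dvd_pr_iff:
  assumes "(S, c) \<in> transversals" "prime q"
  shows "q dvd pr (S, c) \<longleftrightarrow> (\<exists>j\<in>S. c j = q)"
proof -
  have "finite S" using assms(1) finite_F by (auto simp: transversals_def)
  then have "q dvd pr (S, c) \<longleftrightarrow> (\<exists>j\<in>S. q dvd c j)"
    unfolding pr_def using assms(2) by (simp add: prime_dvd_prod_iff)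
  also have "\<dots> \<longleftrightarrow> (\<exists>j\<in>S. c j = q)"
    using transversalD(3)[OF assms(1)] primes_dvd_imp_eq[OF assms(2)] by (metis dvd_refl)
  finally show ?thesis .
qed

lemma dvd_pr_group:
  assumes "(S, c) \<in> transversals" "j \<in> V" "p \<in> Q j"
  shows "p dvd pr (S, c) \<longleftrightarrow> j \<in> S \<and> c j = p"
proof -
  have "prime p" using primeQ assms by blast
  then have "p dvd pr (S, c) \<longleftrightarrow> (\<exists>i\<in>S. c i = p)" by (rule prime_dvd_pr_iff[OF assms(1)])
  also have "\<dots> \<longleftrightarrow> j \<in> S \<and> c j = p"
  proof
    assume "\<exists>i\<in>S. c i = p"
    then obtain i where i: "i \<in> S" "c i = p" by blast
    then have "p \<in> Q i \<inter> Q j" "i \<in> V" using transversalD[OF assms(1) i(1)] assms(3) by auto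
    then have "i = j" using disj assms(2) unfolding disjoint_family_on_def by blast
    then show "j \<in> S \<and> c j = p" using i by simp
  qed blast
  finally show ?thesis .
qed

text \<open>The groups are disjoint, so a prime divisor in \<open>Q j\<close> betrays
  \<open>j\<close>. The support can therefore be read off the integer, which later turns equal LCMs
  into equal unions of supports.\<close>

lemma support_eq:
  assumes "(S, c) \<in> transversals"
  shows "S = {j\<in>V. \<exists>p\<in>Q j. p dvd pr (S, c)}"
proof (rule set_eqI)
  fix j
  show "j \<in> S \<longleftrightarrow> j \<in> {j\<in>V. \<exists>p\<in>Q j. p dvd pr (S, c)}"
    using transversalD[OF assms, of j] dvd_pr_group[OF assms, of j] by blast
qed

lemma transversal_eqI:
  assumes "(S, c) \<in> transversals" "(S, c') \<in> transversals" "\<And>j. j \<in> S \<Longrightarrow> c j = c' j"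
  shows "c = c'"
  using assms by (intro PiE_ext[of c S Q c']) (auto simp: transversals_def)

lemma inj_on_pr: "inj_on pr transversals"
proof (rule inj_onI, clarify)
  fix S c S' c'
  assume t: "(S, c) \<in> transversals" "(S', c') \<in> transversals" and eq: "pr (S, c) = pr (S', c')"
  have S: "S = S'" using support_eq[OF t(1)] support_eq[OF t(2)] unfolding eq by simp
  have "c j = c' j" if "j \<in> S" for j
    using dvd_pr_group[OF t(1), of j "c j"] dvd_pr_group[OF t(2), of j "c j"]
      transversalD[OF t(1) that] that eq by simp
  then show "S = S' \<and> c = c'" using transversal_eqI t S by blast
qed

text \<open>Equal LCMs give equal unions of supports, so two indices share a support because
  \<open>\<F>\<close> is union-free. Comparison with a third index, available as
  \<open>k \<ge> 3\<close>, shows that they also share their primes, so the two integers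
  coincide.\<close>

lemma lcm_free_pr:
  assumes k: "k \<ge> 3" and uf: "union_free k \<F>"
  shows "lcm_free k (pr ` transversals)"
  unfolding lcm_free_def
proof
  assume "\<exists>a :: nat \<Rightarrow> nat. inj_on a {1..k} \<and> a ` {1..k} \<subseteq> pr ` transversals \<and>
    (\<exists>L. \<forall>i j. 1 \<le> i \<and> i < j \<and> j \<le> k \<longrightarrow> lcm (a i) (a j) = L)"
  then obtain a :: "nat \<Rightarrow> nat" and L where a: "inj_on a {1..k}" "a ` {1..k} \<subseteq> pr ` transversals"
    and L: "\<And>i j. 1 \<le> i \<Longrightarrow> i < j \<Longrightarrow> j \<le> k \<Longrightarrow> lcm (a i) (a j) = L" by metis
  have "\<forall>i\<in>{1..k}. \<exists>z\<in>transversals. a i = pr z" using a(2) by blast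
  then obtain z where z: "\<And>i. i \<in> {1..k} \<Longrightarrow> z i \<in> transversals" "\<And>i. i \<in> {1..k} \<Longrightarrow> a i = pr (z i)"
    by metis
  define S where "S i = fst (z i)" for i
  define c where "c i = snd (z i)" for i
  have t: "(S i, c i) \<in> transversals" "pr (S i, c i) = a i" if "i \<in> {1..k}" for i
    using z[OF that] by (simp_all add: S_def c_def)
  have L': "lcm (a i) (a j) = L" if "i \<in> {1..k}" "j \<in> {1..k}" "i \<noteq> j" for i j
    using that L[of i j] L[of j i] by (cases "i < j") (auto simp: lcm.commute)
  have dvdL: "p dvd L \<longleftrightarrow> p dvd a i \<or> p dvd a j"
    if "i \<in> {1..k}" "j \<in> {1..k}" "i \<noteq> j" "prime p" for i j p
  proof
    assume "p dvd L"
    also have "L dvd a i * a j" unfolding L'[OF that(1-3), symmetric] by (intro lcm_least) auto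
    finally show "p dvd a i \<or> p dvd a j" using that(4) by (simp add: prime_dvd_mult_iff)
  next
    have "a i dvd L" "a j dvd L" unfolding L'[OF that(1-3), symmetric] by auto
    then show "p dvd a i \<or> p dvd a j \<Longrightarrow> p dvd L" by (auto intro: dvd_trans)
  qed
  have S: "S i = {g\<in>V. \<exists>p\<in>Q g. p dvd a i}" if "i \<in> {1..k}" for i
    using support_eq[OF t(1)[OF that]] t(2)[OF that] by simp
  have "equal_unions k S {g\<in>V. \<exists>p\<in>Q g. p dvd L}"
    unfolding equal_unions_def
  proof (intro ballI impI)
    fix i j assume ij: "i \<in> {1..k}" "j \<in> {1..k}" "i \<noteq> j"
    have "p dvd L \<longleftrightarrow> p dvd a i \<or> p dvd a j" if "g \<in> V" "p \<in> Q g" for g p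
      using dvdL[OF ij] primeQ[OF that] by blast
    then show "S i \<union> S j = {g\<in>V. \<exists>p\<in>Q g. p dvd L}"
      unfolding S[OF ij(1)] S[OF ij(2)] by blast
  qed
  moreover have "S i \<in> \<F>" if "i \<in> {1..k}" for i using t(1)[OF that] by (auto simp: transversals_def)
  ultimately have "\<not> inj_on S {1..k}" by (intro union_freeD[OF uf])
  then obtain i j where ij: "i \<in> {1..k}" "j \<in> {1..k}" "i \<noteq> j" and Sij: "S i = S j"
    unfolding inj_on_def by blast
  have "card ({1..k} - {i, j}) = k - 2" using ij by (simp add: card_Diff_subset)
  then have "{1..k} - {i, j} \<noteq> {}" using k by (metis card.empty diff_is_0_eq not_less_eq_eq numeral_2_eq_2 numeral_3_eq_3)
  then obtain l where l: "l \<in> {1..k}" "l \<noteq> i" "l \<noteq> j" by blast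
  \<comment> \<open>If \<open>i\<close> and \<open>j\<close> used different primes of one group, then a third member \<open>l\<close> would have to
    contain both of them.\<close>
  have "c i g = c j g" if g: "g \<in> S i" for g
  proof (rule ccontr)
    assume ne: "c i g \<noteq> c j g"
    have gV: "g \<in> V" "c i g \<in> Q g" "prime (c i g)" "c j g \<in> Q g" "prime (c j g)"
      using transversalD[OF t(1)[OF ij(1)] g] transversalD[OF t(1)[OF ij(2)], of g] g Sij by auto
    have own: "p dvd a n \<longleftrightarrow> g \<in> S n \<and> c n g = p" if "n \<in> {1..k}" "p \<in> Q g" for n p
      using dvd_pr_group[OF t(1)[OF that(1)] gV(1) that(2)] t(2)[OF that(1)] by simp
    have "c i g dvd L" using dvdL[OF ij gV(3)] own[OF ij(1) gV(2)] g by blast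
    then have "c i g dvd a l"
      using dvdL[OF ij(2) l(1) l(3)[symmetric] gV(3)] own[OF ij(2) gV(2)] ne by auto
    moreover have "c j g dvd L" using dvdL[OF ij gV(5)] own[OF ij(2) gV(4)] g Sij by blast
    then have "c j g dvd a l"
      using dvdL[OF ij(1) l(1) l(2)[symmetric] gV(5)] own[OF ij(1) gV(4)] ne by auto
    ultimately show False using own[OF l(1) gV(2)] own[OF l(1) gV(4)] ne by auto
  qed
  then have "c i = c j" using transversal_eqI t(1)[OF ij(1)] t(1)[OF ij(2)] Sij by metis
  then have "a i = a j" using t(2)[OF ij(1)] t(2)[OF ij(2)] Sij by simp
  then show False using inj_onD[OF a(1)] ij by blast
qed

lemma pr_bounds:
  assumes "Y \<ge> 1" "z \<in> transversals"
  shows "pr z \<in> {1..Y ^ card V}"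
proof -
  obtain S c where z: "z = (S, c)" by (cases z)
  have t: "(S, c) \<in> transversals" using assms z by simp
  have "S \<subseteq> V" using t FV by (auto simp: transversals_def)
  have "(\<Prod>j\<in>S. c j) \<le> (\<Prod>j\<in>S. Y)" using transversalD[OF t] by (intro prod_mono) auto
  also have "\<dots> \<le> Y ^ card V" using assms(1) card_mono[OF finV \<open>S \<subseteq> V\<close>] by (simp add: power_increasing)
  finally have "pr z \<le> Y ^ card V" by (simp add: z pr_def)
  moreover have "(\<Prod>j\<in>S. c j) > 0" using transversalD(3)[OF t] prime_gt_0_nat by (intro prod_pos) blast
  then have "pr z > 0" by (simp add: z pr_def)
  ultimately show ?thesis by simp
qed

text \<open>Expanding the product of the group sums over \<open>S\<close> gives one reciprocal for
  each choice function, and \<open>pr\<close> is injective.\<close>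

lemma sum_inverse_pr_ge:
  assumes "\<And>j. j \<in> V \<Longrightarrow> \<delta> \<le> (\<Sum>p\<in>Q j. 1 / real p)" "\<delta> \<ge> 0"
  shows "(\<Sum>a\<in>pr ` transversals. 1 / real a) \<ge> (\<Sum>S\<in>\<F>. \<delta> ^ card S)"
proof -
  have "(\<Sum>S\<in>\<F>. \<delta> ^ card S) = (\<Sum>S\<in>\<F>. \<Prod>j\<in>S. \<delta>)" by simp
  also have "\<dots> \<le> (\<Sum>S\<in>\<F>. \<Prod>j\<in>S. \<Sum>p\<in>Q j. 1 / real p)"
    using assms FV by (intro sum_mono prod_mono) auto
  also have "\<dots> = (\<Sum>S\<in>\<F>. \<Sum>c\<in>Pi\<^sub>E S Q. \<Prod>j\<in>S. 1 / real (c j))"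
    using FV finite_Q finite_F(2) by (intro sum.cong refl prod_sum_PiE) auto
  also have "\<dots> = (\<Sum>(S, c)\<in>transversals. \<Prod>j\<in>S. 1 / real (c j))"
    unfolding transversals_def using finite_F FV finite_Q
    by (intro sum.Sigma ballI finite_PiE) auto
  also have "\<dots> = (\<Sum>z\<in>transversals. 1 / real (pr z))"
    by (intro sum.cong) (auto simp: pr_def prod_dividef)
  also have "\<dots> = (\<Sum>a\<in>pr ` transversals. 1 / real a)"
    by (subst sum.reindex[OF inj_on_pr]) simp
  finally show ?thesis .
qed

end

text \<open>Each of the \<open>R * card V\<close> ground elements of the power family receives a
  group of primes of weight at least \<delta>. Discarding the primes up to \<open>K\<close> makes
  every reciprocal at most \<delta>^2, the overshoot allowed per group, and lowers the total by at
  most \<open>K\<close>.\<close>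

lemma lcm_free_max_ge_power:
  fixes \<delta> :: real
  assumes k: "k \<ge> 3" and V: "finite V" and U: "\<U> \<subseteq> Pow V" "union_free k \<U>"
    and m: "\<And>S. S \<in> \<U> \<Longrightarrow> card S = m"
    and \<delta>: "\<delta> > 0" and K: "1 / \<delta>\<^sup>2 \<le> real K" and Y: "Y \<ge> 1"
    and weight: "real (R * card V) * (\<delta> + \<delta>\<^sup>2) \<le> (\<Sum>p\<in>primes_upto Y. 1 / real p) - real K"
    and N: "Y ^ (R * card V) \<le> N"
  shows "lcm_free_max k N \<ge> (real (card \<U>) * \<delta> ^ m) ^ R"
proof -
  let ?X = "primes_upto Y - {..K}" and ?I = "{..<R} \<times> V"
  have "1 / real p \<le> 1" for p :: nat by (cases p) auto
  then have "(\<Sum>p\<in>primes_upto Y \<inter> {..K}. 1 / real p) \<le> (\<Sum>p\<in>primes_upto Y \<inter> {..K}. 1)"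
    by (intro sum_mono)
  also have "\<dots> \<le> real K"
  proof -
    have "primes_upto Y \<inter> {..K} \<subseteq> {1..K}" by (auto simp: primes_upto_def dest: prime_ge_1_nat)
    then have "card (primes_upto Y \<inter> {..K}) \<le> card {1..K}" by (intro card_mono) auto
    then show ?thesis by simp
  qed
  finally have "(\<Sum>p\<in>primes_upto Y. 1 / real p) - real K \<le> (\<Sum>p\<in>?X. 1 / real p)"
    using sum.Int_Diff[of "primes_upto Y" "\<lambda>p. 1 / real p" "{..K}"] by simp
  then have weight': "real (card ?I) * (\<delta> + \<delta>\<^sup>2) \<le> (\<Sum>p\<in>?X. 1 / real p)"
    using weight by (simp add: card_cartesian_product)
  have small: "1 / real p \<le> \<delta>\<^sup>2" if "p \<in> ?X" for p
  proof -
    have "1 / \<delta>\<^sup>2 \<le> real p" using K that by auto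
    moreover have "real p > 0" using that by auto
    ultimately show ?thesis using \<delta> by (simp add: field_simps)
  qed
  obtain Q where Q: "\<forall>i\<in>?I. Q i \<subseteq> ?X \<and> \<delta> \<le> (\<Sum>p\<in>Q i. 1 / real p)" "disjoint_family_on Q ?I"
    using disjoint_groups[of ?I ?X "\<lambda>p. 1 / real p" "\<delta>\<^sup>2" \<delta>] V small weight' \<delta> by auto
  obtain \<G> where G: "\<G> \<subseteq> Pow ?I" "union_free k \<G>" "\<forall>S\<in>\<G>. card S = R * m" "card \<G> = card \<U> ^ R"
    using union_free_uniform_power[OF U(2,1) m V, of R] k by auto
  have "prime p \<and> p \<le> Y" if "j \<in> ?I" "p \<in> Q j" for j p
    using bspec[OF Q(1) that(1)] that(2) by (auto simp: primes_upto_def)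
  then interpret prime_groups ?I Q \<G> Y
    using V G(1) Q(2) by unfold_locales auto
  have "(real (card \<U>) * \<delta> ^ m) ^ R = (\<Sum>S\<in>\<G>. \<delta> ^ card S)"
    using G(3,4) by (simp add: power_mult_distrib power_mult[symmetric] mult.commute)
  also have "\<dots> \<le> (\<Sum>a\<in>pr ` transversals. 1 / real a)"
    using Q(1) \<delta> by (intro sum_inverse_pr_ge) auto
  also have "\<dots> \<le> lcm_free_max k N"
  proof (rule lcm_free_max_ge)
    show "lcm_free k (pr ` transversals)" using k G(2) by (rule lcm_free_pr)
    show "pr ` transversals \<subseteq> {1..N}"
      using pr_bounds[OF Y] N by (fastforce simp: card_cartesian_product)
  qed
  finally show ?thesis .
qed

text \<open>The base family depends on \<delta> alone; only the number \<open>R\<close> of copies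
  grows with \<open>N\<close>.\<close>

lemma lcm_free_max_lower_bound:
  fixes \<delta> :: real
  assumes k: "k \<ge> 3" and cap: "sunflower_capacity k = 2" and \<delta>: "0 < \<delta>" "\<delta> < 1 / 2"
  shows "\<forall>\<^sub>F N in sequentially. lcm_free_max k N \<ge> exp ((1 - 5 * \<delta>) * ln (ln (real N)))"
proof -
  obtain V :: "nat set" and \<U> m where V: "finite V" "V \<noteq> {}" and U: "\<U> \<subseteq> Pow V" "union_free k \<U>"
    and m: "\<And>S. S \<in> \<U> \<Longrightarrow> card S = m"
    and dense: "real (card \<U>) * \<delta> ^ m \<ge> exp (real (card V) * \<delta> * (1 - 2 * \<delta>))"
    using exists_dense_uniform_union_free[of k \<delta>] k cap \<delta> by auto
  define v where "v = real (card V)"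
  have v: "v > 0" using V by (simp add: v_def card_gt_0_iff)
  obtain K :: nat where K: "1 / \<delta>\<^sup>2 \<le> real K" using real_arch_simple by blast
  define L where "L N = ln (ln (real N))" for N :: nat
  \<comment> \<open>This is \<open>ln (z / 2) - K\<close> for the \<open>z\<close> below: a lower
    bound for the prime mass up to \<open>Y\<close> after small primes are discarded.\<close>
  define \<tau> where "\<tau> N = (1 - \<delta>) * L N - ln 2 - real K" for N
  have L: "filterlim L at_top sequentially" unfolding L_def by real_asymp
  have "\<forall>\<^sub>F N in sequentially. L N > 0"
    using filterlim_at_top_dense[THEN iffD1, OF L, rule_format] .
  moreover have "\<forall>\<^sub>F N in sequentially. L N > (ln 2 + real K) / (1 - \<delta>)"
    using filterlim_at_top_dense[THEN iffD1, OF L, rule_format] .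
  moreover have "\<forall>\<^sub>F N in sequentially. L N > (ln 2 + real K + v) / \<delta>"
    using filterlim_at_top_dense[THEN iffD1, OF L, rule_format] .
  moreover have "\<forall>\<^sub>F N in sequentially. L N / \<delta> \<le> exp (\<delta> * L N)"
  proof -
    have "\<forall>\<^sub>F y in at_top. y / \<delta> \<le> exp (\<delta> * y)" using \<delta> by real_asymp
    then show ?thesis using L by (rule eventually_compose_filterlim)
  qed
  moreover have "\<forall>\<^sub>F N in sequentially. N \<ge> (3::nat)" by (rule eventually_ge_at_top)
  ultimately show ?thesis
  proof eventually_elim
    case (elim N)
    have lnN: "ln (real N) > 0" using elim by simp
    have expL: "exp (L N) = ln (real N)" using lnN by (simp add: L_def)
    have \<tau>: "\<tau> N > 0" using elim \<delta> by (simp add: \<tau>_def field_simps)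
    \<comment> \<open>Primes up to about exp ((ln N)^(1 - \<delta>)) still carry a proportion 1 -
      \<delta> of \<open>ln (ln N)\<close>, and up to (ln N)^\<delta> of them can be multiplied
      within \<open>N\<close>.\<close>
    define z where "z = exp ((1 - \<delta>) * L N)"
    have z: "z \<ge> 1" unfolding z_def using elim \<delta> by simp
    define Y where "Y = nat \<lfloor>exp z\<rfloor>"
    have expz: "exp z \<ge> 1" using z by simp
    have Y: "real Y \<le> exp z" "exp z \<le> real Y + 1" "Y \<ge> 1"
      unfolding Y_def using expz by (linarith, linarith, simp add: le_nat_iff)
    \<comment> \<open>As many copies of the base family as the prime mass \<open>\<tau> N\<close>
      can supply.\<close>
    define R where "R = nat \<lfloor>\<tau> N / (v * (\<delta> + \<delta>\<^sup>2))\<rfloor>"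
    have pos: "v * (\<delta> + \<delta>\<^sup>2) > 0" using v \<delta> by (intro mult_pos_pos add_pos_pos) auto
    then have "\<tau> N / (v * (\<delta> + \<delta>\<^sup>2)) \<ge> 0" using \<tau> by simp
    then have R: "real R \<le> \<tau> N / (v * (\<delta> + \<delta>\<^sup>2))" "real R \<ge> \<tau> N / (v * (\<delta> + \<delta>\<^sup>2)) - 1"
      unfolding R_def by linarith+
    have Rv: "real R * v * (\<delta> + \<delta>\<^sup>2) \<le> \<tau> N" using R(1) pos by (simp add: field_simps)
    have "lcm_free_max k N \<ge> (real (card \<U>) * \<delta> ^ m) ^ R"
    proof (rule lcm_free_max_ge_power[OF k V(1) U m \<delta>(1) K Y(3)])
      have "z / 2 \<le> ln (real Y + 1) / 2" using Y(2) by (simp add: ln_ge_iff)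
      then have "ln (z / 2) \<le> ln (ln (real Y + 1) / 2)" using z by (intro ln_mono) auto
      also have "\<dots> \<le> (\<Sum>p\<in>primes_upto Y. 1 / real p)" by (rule sum_inverse_primes_ge[OF Y(3)])
      finally have "\<tau> N \<le> (\<Sum>p\<in>primes_upto Y. 1 / real p) - real K"
        by (simp add: \<tau>_def z_def ln_div)
      then show "real (R * card V) * (\<delta> + \<delta>\<^sup>2) \<le> (\<Sum>p\<in>primes_upto Y. 1 / real p) - real K"
        using Rv by (simp add: v_def)
      \<comment> \<open>The integers have at most \<open>R * v\<close> prime factors; this number is
        at most \<open>L N / \<delta>\<close>, hence at most
        \<open>exp (\<delta> * L N)\<close>.\<close>
      have "real R * v * \<delta> \<le> L N"
      proof -
        have "real R * v * \<delta> \<le> real R * v * (\<delta> + \<delta>\<^sup>2)" using v by (intro mult_left_mono) auto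
        also have "\<dots> \<le> \<tau> N" by (rule Rv)
        also have "\<dots> \<le> L N"
        proof -
          have "0 \<le> \<delta> * L N" using \<delta> elim by simp
          moreover have "0 \<le> ln (2::real)" by simp
          ultimately show ?thesis by (simp add: \<tau>_def algebra_simps)
        qed
        finally show ?thesis .
      qed
      then have "real R * v \<le> L N / \<delta>" using \<delta> by (simp add: field_simps)
      also have "\<dots> \<le> exp (\<delta> * L N)" using elim by simp
      finally have "real R * v * z \<le> exp (\<delta> * L N) * z" using z by (intro mult_right_mono) auto
      also have "\<dots> = ln (real N)"
        unfolding z_def expL[symmetric] exp_add[symmetric] by (simp add: algebra_simps)
      finally have "exp (real R * v * z) \<le> exp (ln (real N))" by simp
      also have "\<dots> = real N" using elim by simp
      finally have expN: "exp (real R * v * z) \<le> real N" .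
      have "real (Y ^ (R * card V)) \<le> exp z ^ (R * card V)"
        using Y(1) by (simp add: power_mono)
      also have "\<dots> = exp (real R * v * z)" by (simp add: exp_of_nat_mult[symmetric] v_def)
      also note expN
      finally show "Y ^ (R * card V) \<le> N" by (simp only: of_nat_le_iff)
    qed
    moreover have "exp ((1 - 5 * \<delta>) * L N) \<le> (real (card \<U>) * \<delta> ^ m) ^ R"
    proof -
      \<comment> \<open>The ratio of the exponent gained per ground element, \<delta>(1 -
        2\<delta>), to the prime mass spent, \<delta>(1 + \<delta>). The total loss 5\<delta>
        consists of 3\<delta> from \<open>c\<close>, \<delta> from the range of primes and \<delta>
        for the constants.\<close>
      define c where "c = (1 - 2 * \<delta>) / (1 + \<delta>)"
      have c: "0 \<le> c" "c \<le> 1" using \<delta> by (auto simp: c_def field_simps)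
      have c3: "1 - 3 * \<delta> \<le> c" using \<delta> by (simp add: c_def field_simps)
      have "(1 - 3 * \<delta>) * ((1 - \<delta>) * L N) \<le> c * ((1 - \<delta>) * L N)"
        using c3 elim \<delta> by (intro mult_right_mono) auto
      moreover have "(1 - 4 * \<delta>) * L N \<le> (1 - 3 * \<delta>) * ((1 - \<delta>) * L N)"
      proof -
        have "(1 - 4 * \<delta>) * L N \<le> ((1 - 3 * \<delta>) * (1 - \<delta>)) * L N"
          using elim by (intro mult_right_mono) (auto simp: algebra_simps)
        then show ?thesis by (simp add: mult.assoc)
      qed
      moreover have "c * (ln 2 + real K) \<le> 1 * (ln 2 + real K)"
        using c by (intro mult_right_mono) auto
      moreover have "ln 2 + real K + v < \<delta> * L N" using elim \<delta> by (simp add: field_simps)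
      ultimately have "(1 - 5 * \<delta>) * L N \<le> c * \<tau> N - v"
        by (simp add: \<tau>_def algebra_simps)
      also have "\<dots> \<le> c * \<tau> N - v * \<delta> * (1 - 2 * \<delta>)"
      proof -
        have "\<delta> * (1 - 2 * \<delta>) \<le> 1 * 1" using \<delta> by (intro mult_mono) auto
        then have "v * (\<delta> * (1 - 2 * \<delta>)) \<le> v * 1" using v by (intro mult_left_mono) auto
        then show ?thesis by (simp add: mult.assoc)
      qed
      also have "\<dots> = (\<tau> N / (v * (\<delta> + \<delta>\<^sup>2)) - 1) * (v * \<delta> * (1 - 2 * \<delta>))"
      proof -
        have "\<delta> + \<delta>\<^sup>2 = \<delta> * (1 + \<delta>)" by (simp add: power2_eq_square algebra_simps)
        then have "\<tau> N / (v * (\<delta> + \<delta>\<^sup>2)) * (v * \<delta> * (1 - 2 * \<delta>)) = c * \<tau> N"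
          using v \<delta> by (simp add: c_def)
        then show ?thesis by (simp add: left_diff_distrib)
      qed
      also have "\<dots> \<le> real R * (v * \<delta> * (1 - 2 * \<delta>))"
        using R(2) v \<delta> by (intro mult_right_mono) auto
      finally have "exp ((1 - 5 * \<delta>) * L N) \<le> exp (real R * (v * \<delta> * (1 - 2 * \<delta>)))" by simp
      also have "\<dots> = exp (v * \<delta> * (1 - 2 * \<delta>)) ^ R" by (rule exp_of_nat_mult)
      also have "\<dots> \<le> (real (card \<U>) * \<delta> ^ m) ^ R"
        using dense by (intro power_mono) (auto simp: v_def)
      finally show ?thesis .
    qed
    ultimately show ?case by (simp add: L_def)
  qed
qed

section \<open>The upper bound and the limiting exponent\<close>

lemma lcm_free_max_le:
  assumes "k \<ge> 1" "N \<ge> 1"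
  shows "lcm_free_max k N \<le> 1 + ln (real N)"
proof -
  obtain A where A: "A \<subseteq> {1..N}" "(\<Sum>a\<in>A. 1 / real a) = lcm_free_max k N"
    using obtain_lcm_free_max[OF assms(1)] by metis
  have "(\<Sum>a\<in>A. 1 / real a) \<le> (\<Sum>a=1..N. 1 / real a)" using A(1) by (intro sum_mono2) auto
  also have "\<dots> = harm N" by (simp add: harm_def inverse_eq_divide)
  also have "\<dots> \<le> 1 + ln (real N)"
    \<comment> \<open>The library sequence is indexed through \<open>Suc\<close>, so the indices 0
      and \<open>N - 1\<close> compare \<open>harm N - ln N\<close> with
      \<open>harm 1 - ln 1 = 1\<close>.\<close>
    using decseqD[OF decseq_harm_diff_ln, of 0 "N - 1"] assms(2) by (simp add: harm_def)
  finally show ?thesis using A(2) by simp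
qed

text \<open>This expression solves \<open>lcm_free_max k N = ln N powr (1 - \<epsilon> N)\<close>
  for \<open>\<epsilon> N\<close>. The lower bound keeps it at most 5\<delta>, and the harmonic sum
  keeps it at least \<open>- ln 2 / ln (ln N)\<close>.\<close>

lemma lcm_free_max_exponent:
  assumes k: "k \<ge> 3" and cap: "sunflower_capacity k = 2"
  shows "(\<lambda>N. 1 - ln (lcm_free_max k N) / ln (ln (real N))) \<longlonglongrightarrow> 0"
  unfolding tendsto_iff dist_real_def
proof (intro allI impI)
  fix r :: real assume r: "r > 0"
  define \<delta> where "\<delta> = min (1 / 4) (r / 10)"
  have \<delta>: "0 < \<delta>" "\<delta> < 1 / 2" "5 * \<delta> < r" using r by (auto simp: \<delta>_def min_def)
  define L where "L N = ln (ln (real N))" for N :: nat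
  have L: "filterlim L at_top sequentially" unfolding L_def by real_asymp
  have "\<forall>\<^sub>F N in sequentially. L N > max 0 (ln 2 / r)"
    using filterlim_at_top_dense[THEN iffD1, OF L, rule_format] .
  moreover have "\<forall>\<^sub>F N in sequentially. N \<ge> (3::nat)" by (rule eventually_ge_at_top)
  moreover note lcm_free_max_lower_bound[OF k cap \<delta>(1,2)]
  ultimately show "\<forall>\<^sub>F N in sequentially. \<bar>1 - ln (lcm_free_max k N) / ln (ln (real N)) - 0\<bar> < r"
  proof eventually_elim
    case (elim N)
    have "ln 2 / r < L N" using elim(1) by simp
    then have "ln 2 < r * L N" using r by (simp add: field_simps)
    moreover have "L N > 0" using elim(1) by linarith
    ultimately have L0: "L N > 0" "ln 2 < r * L N" by blast+
    have lnN: "ln (real N) > 0" using elim by simp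
    have expL: "exp (L N) = ln (real N)" using lnN by (simp add: L_def)
    have lnN1: "ln (real N) \<ge> 1" using L0 expL by (metis one_le_exp_iff less_imp_le)
    define f where "f = lcm_free_max k N"
    have lo: "exp ((1 - 5 * \<delta>) * L N) \<le> f" using elim by (simp add: f_def L_def)
    then have f: "f > 0" by (rule less_le_trans[OF exp_gt_zero])
    have lo': "(1 - 5 * \<delta>) * L N \<le> ln f" using lo f by (simp add: ln_ge_iff)
    have "f \<le> 1 + ln (real N)" unfolding f_def using k elim by (intro lcm_free_max_le) auto
    also have "\<dots> \<le> 2 * ln (real N)" using lnN1 by simp
    finally have "ln f \<le> ln (2 * ln (real N))" using f by (intro ln_mono) auto
    then have hi: "ln f \<le> ln 2 + L N" using lnN by (simp add: ln_mult L_def)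
    have "5 * \<delta> * L N < r * L N" using \<delta>(3) L0 by (intro mult_strict_right_mono) auto
    moreover have "L N - 5 * \<delta> * L N \<le> ln f" using lo' by (simp add: algebra_simps)
    ultimately have "\<bar>L N - ln f\<bar> < r * L N" using hi L0 by linarith
    then have "\<bar>L N - ln f\<bar> / L N < r" using L0 by (simp add: field_simps)
    moreover have "\<bar>L N - ln f\<bar> / L N = \<bar>1 - ln f / L N\<bar>"
      using L0 by (simp add: diff_divide_distrib[symmetric] abs_divide field_simps)
    ultimately show ?case by (simp add: f_def L_def)
  qed
qed

theorem theorem1p4:
  fixes k :: nat
  assumes "k \<ge> 3"
  shows "sunflower_capacity k = 2 \<longleftrightarrow>
    (\<exists>\<epsilon> :: nat \<Rightarrow> real. \<epsilon> \<longlonglongrightarrow> 0 \<and>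
       (\<forall>\<^sub>F N in sequentially. lcm_free_max k N = ln (real N) powr (1 - \<epsilon> N)))"
proof
  assume cap: "sunflower_capacity k = 2"
  define L where "L N = ln (ln (real N))" for N :: nat
  have L: "filterlim L at_top sequentially" unfolding L_def by real_asymp
  have "\<forall>\<^sub>F N in sequentially. L N > 0"
    using filterlim_at_top_dense[THEN iffD1, OF L, rule_format] .
  \<comment> \<open>The value 1/4 is arbitrary: the bound serves here only to make
    \<open>lcm_free_max k N\<close> positive, so that \<open>exp\<close> undoes its
    \<open>ln\<close>.\<close>
  moreover have "\<forall>\<^sub>F N in sequentially. lcm_free_max k N \<ge> exp ((1 - 5 * (1 / 4)) * ln (ln (real N)))"
    using assms cap by (intro lcm_free_max_lower_bound) auto
  moreover have "\<forall>\<^sub>F N in sequentially. N \<ge> (3::nat)" by (rule eventually_ge_at_top)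
  ultimately have "\<forall>\<^sub>F N in sequentially. lcm_free_max k N =
      ln (real N) powr (1 - (1 - ln (lcm_free_max k N) / ln (ln (real N))))"
  proof eventually_elim
    case (elim N)
    have "lcm_free_max k N > 0" using elim(2) by (rule less_le_trans[OF exp_gt_zero])
    moreover have "ln (real N) > 0" using elim(3) by simp
    ultimately show ?case using elim(1) by (simp add: powr_def L_def)
  qed
  then show "\<exists>\<epsilon> :: nat \<Rightarrow> real. \<epsilon> \<longlonglongrightarrow> 0 \<and>
      (\<forall>\<^sub>F N in sequentially. lcm_free_max k N = ln (real N) powr (1 - \<epsilon> N))"
    using lcm_free_max_exponent[OF assms cap] by blast
next
  assume "\<exists>\<epsilon> :: nat \<Rightarrow> real. \<epsilon> \<longlonglongrightarrow> 0 \<and>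
      (\<forall>\<^sub>F N in sequentially. lcm_free_max k N = ln (real N) powr (1 - \<epsilon> N))"
  then show "sunflower_capacity k = 2"
    using sunflower_capacity_eq_2I[of k] assms by (elim exE conjE) simp
qed

end
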